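(* Let $a,b,c$ be nonzero real numbers and let $\epsilon_0,d,m,w$ be positive real numbers with $m\neq d^2$. Consider the system $$\begin{aligned} &ia_1\psi_t+a\psi_{xx}+a_2\psi_{yy}+a_3\psi_{tt}+a_4\psi_{ty}+ia_5\psi_y=(b-wm)|\psi|^2\psi-w\,\psi\,\phi,\\ &\phi_{xx}+\frac{1}{d^2-m}(\phi_{yy}-\phi_{tt})=(|\psi|^2)_{yy}, \end{aligned}$$ for a complex-valued function $\psi=u+iv$ and a real-valued function $\phi$ of $(x,y,t)$, where $$a_1=\frac{d-mc}{(d^2-m)\sqrt m},\quad a_2=\frac{\epsilon_0d^2}{(d^2-m)^2},\quad a_3=\frac{\epsilon_0m}{(d^2-m)^2},\quad a_4=-\frac{2\epsilon_0d\sqrt m}{(d^2-m)^2},\quad a_5=\frac{dc-1}{d^2-m}.$$ Then the Lie symmetry algebra of this system is six-dimensional, with basis $$\begin{aligned} &\bar{\mathcal X}_1=\partial_t,\quad \bar{\mathcal X}_2=\partial_x,\quad \bar{\mathcal X}_3=\partial_y,\quad \bar{\mathcal X}_4=-v\partial_u+u\partial_v,\\ &\bar{\mathcal X}_5=(dt+\sqrt m\,y)(-v\partial_u+u\partial_v)+\frac{1}{w\sqrt m}\,\partial_\phi,\\ &\bar{\mathcal X}_6=(dt+\sqrt m\,y)^2(-v\partial_u+u\partial_v)+\frac{2(dt+\sqrt m\,y)}{w\sqrt m}\,\partial_\phi . \end{aligned}$$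
   Context: The Lie symmetry algebra of a system of PDEs is the Lie algebra (under the commutator of vector fields) of all smooth vector fields on the space of independent and dependent variables, here $(x,y,t,u,v,\phi)$, that generate local one-parameter groups of point transformations mapping solutions to solutions; equivalently, those whose prolongation annihilates the equations on the solution set (the complex equation being split into its real and imaginary parts with $\psi=u+iv$). *)

theory Defs
  imports "HOL-Analysis.Analysis" "HOL-Library.Function_Algebras"
begin

instantiation "fun" :: (type, real_vector) real_vector
begin

definition scaleR_fun :: "real \<Rightarrow> ('a \<Rightarrow> 'b) \<Rightarrow> 'a \<Rightarrow> 'b"
  where "scaleR_fun r f = (\<lambda>x. r *\<^sub>R f x)"

instance
  by standard (auto simp: scaleR_fun_def fun_eq_iff algebra_simps)

end

primrec C_times :: "nat \<Rightarrow> ('a::real_normed_vector \<Rightarrow> 'b::real_normed_vector) \<Rightarrow> bool" where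
  "C_times 0 f \<longleftrightarrow> continuous_on UNIV f"
| "C_times (Suc n) f \<longleftrightarrow>
     (\<forall>x. f differentiable (at x)) \<and> (\<forall>h. C_times n (\<lambda>x. frechet_derivative f (at x) h))"

definition smooth :: "('a::real_normed_vector \<Rightarrow> 'b::real_normed_vector) \<Rightarrow> bool"
  where "smooth f \<longleftrightarrow> (\<forall>n. C_times n f)"

definition lie_bracket :: "('a::real_normed_vector \<Rightarrow> 'a) \<Rightarrow> ('a \<Rightarrow> 'a) \<Rightarrow> 'a \<Rightarrow> 'a" where
  "lie_bracket X Y =
     (\<lambda>z. frechet_derivative Y (at z) (X z) - frechet_derivative X (at z) (Y z))"

definition lie_algebra_of_fields :: "('a::real_normed_vector \<Rightarrow> 'a) set \<Rightarrow> bool" where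
  "lie_algebra_of_fields G \<longleftrightarrow>
     (\<forall>X\<in>G. smooth X) \<and> subspace G \<and> (\<forall>X\<in>G. \<forall>Y\<in>G. lie_bracket X Y \<in> G)"

text \<open>
  \<open>'p\<close> indexes the independent and \<open>'q\<close> the dependent variables. In a 2-jet \<open>((z, p), r)\<close>,
  \<open>z\<close> is a point (independent variables, dependent variables), \<open>p $ J $ i\<close> is the jet
  coordinate of the first derivative of the \<open>J\<close>-th dependent variable in direction \<open>i\<close>, and
  \<open>r $ J $ i $ k\<close> that of its second derivative in directions \<open>i\<close> and \<open>k\<close>. The type does not
  impose symmetry of second derivatives; genuine 2-jets are those in \<open>jet2_space\<close>.
\<close>

type_synonym ('p, 'q) jet0 = "(real ^ 'p) \<times> (real ^ 'q)"
type_synonym ('p, 'q) jet1 = "('p, 'q) jet0 \<times> (real ^ 'p ^ 'q)"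
type_synonym ('p, 'q) jet2 = "('p, 'q) jet1 \<times> (real ^ 'p ^ 'p ^ 'q)"

definition jet2_space :: "('p::finite, 'q::finite) jet2 set" where
  "jet2_space = {j. \<forall>J i k. snd j $ J $ i $ k = snd j $ J $ k $ i}"

text \<open>
  Total derivatives of functions on the 0-jets and on the 1-jets: the derivative along the
  lift of the \<open>i\<close>-th coordinate direction.
\<close>

definition total_D0 ::
    "'p \<Rightarrow> (('p::finite, 'q::finite) jet0 \<Rightarrow> 'e::real_normed_vector) \<Rightarrow> ('p, 'q) jet1 \<Rightarrow> 'e" where
  "total_D0 i F j = frechet_derivative F (at (fst j)) (axis i 1, \<chi> J. snd j $ J $ i)"

definition total_D1 ::
    "'p \<Rightarrow> (('p::finite, 'q::finite) jet1 \<Rightarrow> 'e::real_normed_vector) \<Rightarrow> ('p, 'q) jet2 \<Rightarrow> 'e" where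
  "total_D1 i F j = frechet_derivative F (at (fst j))
     ((axis i 1, \<chi> J. snd (fst j) $ J $ i), \<chi> J k. snd j $ J $ k $ i)"

text \<open>
  For the field \<open>\<Sum>\<^sub>i \<xi>\<^sup>i \<partial>\<^sub>i + \<Sum>\<^sub>J \<eta>\<^sup>J \<partial>\<^sub>J\<close>, the coefficients of the prolongation are
  \<open>\<eta>\<^sup>J\<^sub>i = D\<^sub>i \<eta>\<^sup>J - \<Sum>\<^sub>k (D\<^sub>i \<xi>\<^sup>k) u\<^sup>J\<^sub>k\<close> and
  \<open>\<eta>\<^sup>J\<^sub>i\<^sub>k = D\<^sub>k \<eta>\<^sup>J\<^sub>i - \<Sum>\<^sub>l (D\<^sub>k \<xi>\<^sup>l) u\<^sup>J\<^sub>i\<^sub>l\<close>.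
\<close>

definition prolong_coeff1 ::
    "(('p::finite, 'q::finite) jet0 \<Rightarrow> ('p, 'q) jet0) \<Rightarrow> ('p, 'q) jet1 \<Rightarrow> real ^ 'p ^ 'q" where
  "prolong_coeff1 X j =
     (\<chi> J i. total_D0 i (\<lambda>z. snd (X z) $ J) j
            - (\<Sum>k\<in>UNIV. total_D0 i (\<lambda>z. fst (X z) $ k) j * snd j $ J $ k))"

definition prolong_coeff2 ::
    "(('p::finite, 'q::finite) jet0 \<Rightarrow> ('p, 'q) jet0) \<Rightarrow> ('p, 'q) jet2 \<Rightarrow> real ^ 'p ^ 'p ^ 'q" where
  "prolong_coeff2 X j =
     (\<chi> J i k. total_D1 k (\<lambda>j'. prolong_coeff1 X j' $ J $ i) j
              - (\<Sum>l\<in>UNIV. total_D0 k (\<lambda>z. fst (X z) $ l) (fst j) * snd j $ J $ i $ l))"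

definition prolong2 ::
    "(('p::finite, 'q::finite) jet0 \<Rightarrow> ('p, 'q) jet0) \<Rightarrow> ('p, 'q) jet2 \<Rightarrow> ('p, 'q) jet2" where
  "prolong2 X j = ((X (fst (fst j)), prolong_coeff1 X (fst j)), prolong_coeff2 X j)"

text \<open>
  A second-order system is given by a differential function \<open>\<Delta>\<close> on 2-jets, its solution set
  being \<open>{j \<in> jet2_space. \<Delta> j = 0}\<close>. The prolongation of \<open>X\<close> acts on \<open>\<Delta>\<close> as directional derivative.
\<close>

definition lie_symmetry_algebra ::
    "(('p::finite, 'q::finite) jet2 \<Rightarrow> 'e::real_normed_vector) \<Rightarrow>
     (('p, 'q) jet0 \<Rightarrow> ('p, 'q) jet0) set" where
  "lie_symmetry_algebra \<Delta> =
     {X. smooth X \<and>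
         (\<forall>j\<in>jet2_space. \<Delta> j = 0 \<longrightarrow> frechet_derivative \<Delta> (at j) (prolong2 X j) = 0)}"

text \<open>
  The independent variables are \<open>(x, y, t)\<close> with indices 1, 2, 3 and the dependent
  variables \<open>(u, v, \<phi>)\<close> with indices 1, 2, 3.
\<close>

type_synonym point = "(3, 3) jet0"

definition coord_y :: "point \<Rightarrow> real" where "coord_y z = fst z $ 2"
definition coord_t :: "point \<Rightarrow> real" where "coord_t z = fst z $ 3"
definition coord_u :: "point \<Rightarrow> real" where "coord_u z = snd z $ 1"
definition coord_v :: "point \<Rightarrow> real" where "coord_v z = snd z $ 2"

definition phi :: "point \<Rightarrow> real" where "phi z = snd z $ 3"
definition psi :: "point \<Rightarrow> complex" where "psi z = Complex (coord_u z) (coord_v z)"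

abbreviation D\<^sub>x :: "(point \<Rightarrow> 'e::real_normed_vector) \<Rightarrow> (3, 3) jet1 \<Rightarrow> 'e" where "D\<^sub>x \<equiv> total_D0 1"
abbreviation D\<^sub>y :: "(point \<Rightarrow> 'e::real_normed_vector) \<Rightarrow> (3, 3) jet1 \<Rightarrow> 'e" where "D\<^sub>y \<equiv> total_D0 2"
abbreviation D\<^sub>t :: "(point \<Rightarrow> 'e::real_normed_vector) \<Rightarrow> (3, 3) jet1 \<Rightarrow> 'e" where "D\<^sub>t \<equiv> total_D0 3"

abbreviation D\<^sub>x\<^sub>x :: "(point \<Rightarrow> 'e::real_normed_vector) \<Rightarrow> (3, 3) jet2 \<Rightarrow> 'e"
  where "D\<^sub>x\<^sub>x F \<equiv> total_D1 1 (D\<^sub>x F)"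
abbreviation D\<^sub>y\<^sub>y :: "(point \<Rightarrow> 'e::real_normed_vector) \<Rightarrow> (3, 3) jet2 \<Rightarrow> 'e"
  where "D\<^sub>y\<^sub>y F \<equiv> total_D1 2 (D\<^sub>y F)"
abbreviation D\<^sub>t\<^sub>t :: "(point \<Rightarrow> 'e::real_normed_vector) \<Rightarrow> (3, 3) jet2 \<Rightarrow> 'e"
  where "D\<^sub>t\<^sub>t F \<equiv> total_D1 3 (D\<^sub>t F)"
abbreviation D\<^sub>t\<^sub>y :: "(point \<Rightarrow> 'e::real_normed_vector) \<Rightarrow> (3, 3) jet2 \<Rightarrow> 'e"
  where "D\<^sub>t\<^sub>y F \<equiv> total_D1 2 (D\<^sub>t F)"

definition psi_residual ::
    "real \<Rightarrow> real \<Rightarrow> real \<Rightarrow> real \<Rightarrow> real \<Rightarrow> real \<Rightarrow> real \<Rightarrow> real \<Rightarrow> real \<Rightarrow> (3, 3) jet2 \<Rightarrow> complex" where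
  "psi_residual a a1 a2 a3 a4 a5 b w m j =
     (let z = fst (fst j) in
       \<i> * of_real a1 * D\<^sub>t psi (fst j) + of_real a * D\<^sub>x\<^sub>x psi j + of_real a2 * D\<^sub>y\<^sub>y psi j
       + of_real a3 * D\<^sub>t\<^sub>t psi j + of_real a4 * D\<^sub>t\<^sub>y psi j + \<i> * of_real a5 * D\<^sub>y psi (fst j)
       - (of_real (b - w * m) * of_real ((cmod (psi z))\<^sup>2) * psi z
          - of_real w * psi z * of_real (phi z)))"

definition phi_residual :: "real \<Rightarrow> real \<Rightarrow> (3, 3) jet2 \<Rightarrow> real" where
  "phi_residual d m j =
     D\<^sub>x\<^sub>x phi j + 1 / (d\<^sup>2 - m) * (D\<^sub>y\<^sub>y phi j - D\<^sub>t\<^sub>t phi j) - D\<^sub>y\<^sub>y (\<lambda>z. (cmod (psi z))\<^sup>2) j"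

definition pde_system ::
    "real \<Rightarrow> real \<Rightarrow> real \<Rightarrow> real \<Rightarrow> real \<Rightarrow> real \<Rightarrow> real \<Rightarrow> real \<Rightarrow> real \<Rightarrow> real \<Rightarrow>
     (3, 3) jet2 \<Rightarrow> real \<times> real \<times> real" where
  "pde_system a a1 a2 a3 a4 a5 b w m d j =
     (Re (psi_residual a a1 a2 a3 a4 a5 b w m j),
      Im (psi_residual a a1 a2 a3 a4 a5 b w m j),
      phi_residual d m j)"

definition field_x :: "point \<Rightarrow> point" where "field_x z = (axis 1 1, 0)"
definition field_y :: "point \<Rightarrow> point" where "field_y z = (axis 2 1, 0)"
definition field_t :: "point \<Rightarrow> point" where "field_t z = (axis 3 1, 0)"
definition field_u :: "point \<Rightarrow> point" where "field_u z = (0, axis 1 1)"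
definition field_v :: "point \<Rightarrow> point" where "field_v z = (0, axis 2 1)"
definition field_phi :: "point \<Rightarrow> point" where "field_phi z = (0, axis 3 1)"

definition rot_uv :: "point \<Rightarrow> point" where
  "rot_uv z = - coord_v z *\<^sub>R field_u z + coord_u z *\<^sub>R field_v z"

end

(* The prolongation condition is polynomial in the jet coordinates. Its part of first degree in the
   second derivatives says that the independent components xi do not involve (u, v, phi) and that
   their Jacobian is conformal for the symbols of both equations; the two symbols have no common
   conformal motion other than a homothety sigma. The remaining part of the equation for psi
   makes the (u, v)-component a rotation by an angle theta (with a scaling tau) and gives
   sigma m = - 2 B grad theta, where m is the first-order part and B the degenerate second-order symbol;
   m is not in the range of B, whence sigma = 0 and theta is a function of s = d t + sqrt m y alone.
   The terms without derivatives give tau = 0 and eta^phi = theta'(s) / (w sqrt m), and the equation for phi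
   leaves the third derivative of theta zero because m and d^2 differ. *)

theory Submission
  imports Defs
begin

text \<open>The condition is imposed only on solution jets, so coefficients cannot be compared
  freely. Over a fixed 1-jet the solution jets form an affine space, because each equation can be
  solved for an xx-derivative. Differences of its points carry the terms linear in the second
  derivatives, one base point carries the rest, and both are evaluated at jets with very few nonzero
  entries. The coefficients explain \<open>s\<close>: in the (y, t)-plane the second-order symbol of
  the equation for psi is a perfect square, \<open>e * (d * q - \<mu> * r)^2\<close> on the covector
  (q, r) with \<open>\<mu> = sqrt m\<close>, and the differential (\<mu>, d) of \<open>s\<close>
  spans its kernel. On that covector the first-order part takes the value
  \<open>a1 * d + a5 * \<mu> = 1 / \<mu>\<close>, in which c has cancelled. That it is nonzero
  excludes the homothety, and its value is the origin of the factor 1 / (w sqrt m) in the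
  phi-component. A boost in the (y, t)-plane would preserve the symbol of the equation for phi; the
  degenerate symbol of the other equation rules it out.\<close>

section \<open>Smooth functions and directional derivatives\<close>

text \<open>With the direction fixed, the derivative is again a function of the point. It can
  therefore be iterated, and \<open>C_times\<close> passes to it one direction at a time.\<close>

definition dir_deriv :: "'a \<Rightarrow> ('a::real_normed_vector \<Rightarrow> 'b::real_normed_vector) \<Rightarrow> 'a \<Rightarrow> 'b" where
  "dir_deriv h F = (\<lambda>z. frechet_derivative F (at z) h)"

lemma dir_deriv_eq: "(F has_derivative F') (at z) \<Longrightarrow> dir_deriv h F z = F' h"
  by (simp add: dir_deriv_def frechet_derivative_at[symmetric])

lemma dir_deriv_const [simp]: "dir_deriv h (\<lambda>z. c) = (\<lambda>z. 0)"
  by (simp add: dir_deriv_def fun_eq_iff)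

lemma smooth_C_times: "smooth f \<Longrightarrow> C_times n f"
  by (simp add: smooth_def)

lemma smooth_differentiable: "smooth f \<Longrightarrow> f differentiable (at x)"
  using smooth_C_times[of f "Suc 0"] by simp

lemma smooth_has_derivative: "smooth f \<Longrightarrow> (f has_derivative frechet_derivative f (at x)) (at x)"
  using smooth_differentiable frechet_derivative_works by blast

lemma smooth_dir_deriv: "smooth f \<Longrightarrow> smooth (dir_deriv h f)"
  unfolding smooth_def dir_deriv_def using C_times.simps(2) by blast

lemma smooth_isCont: "smooth f \<Longrightarrow> isCont f x"
  using smooth_differentiable differentiable_imp_continuous_within by blast

text \<open>The recursion asks only for differentiability at the upper level, so continuity has to
  be recovered in the base case. The product rule needs this, since one factor in each term stays
  undifferentiated.\<close>

lemma C_times_SucD: "C_times (Suc n) f \<Longrightarrow> C_times n f"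
proof (induction n arbitrary: f)
  case 0
  then show ?case
    by (auto simp: continuous_on_eq_continuous_at differentiable_imp_continuous_within)
qed auto

lemma C_times_const: "C_times n (\<lambda>x. c)"
  by (induction n arbitrary: c) auto

lemma C_times_bounded_linear_comp:
  assumes L: "bounded_linear L"
  shows "C_times n f \<Longrightarrow> C_times n (\<lambda>x. L (f x))"
proof (induction n arbitrary: f)
  case 0
  then show ?case
    using bounded_linear.continuous_on[OF L] by auto
next
  case (Suc n)
  have D: "((\<lambda>x. L (f x)) has_derivative (\<lambda>h. L (frechet_derivative f (at x) h))) (at x)" for x
    using Suc.prems by (intro bounded_linear.has_derivative[OF L]) (simp add: frechet_derivative_works[symmetric])
  have "frechet_derivative (\<lambda>x. L (f x)) (at x) h = L (frechet_derivative f (at x) h)" for x h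
    using frechet_derivative_at[OF D] by metis
  then show ?case
    using Suc D[THEN differentiableI] by auto
qed

lemma smooth_bounded_linear_comp: "bounded_linear L \<Longrightarrow> smooth f \<Longrightarrow> smooth (\<lambda>x. L (f x))"
  by (simp add: smooth_def C_times_bounded_linear_comp)

lemma smooth_const: "smooth (\<lambda>x. c)"
  by (simp add: smooth_def C_times_const)

lemma smooth_bounded_linear:
  assumes L: "bounded_linear L"
  shows "smooth L"
proof -
  have "C_times n L" for n
  proof (cases n)
    case 0
    then show ?thesis using L by (simp add: linear_continuous_on)
  next
    case (Suc k)
    have D: "(L has_derivative L) (at x)" for x
      using L bounded_linear_imp_has_derivative by blast
    have "frechet_derivative L (at x) h = L h" for x h
      using frechet_derivative_at[OF D] by metis
    then show ?thesis
      using Suc D by (auto simp: differentiable_def C_times_const)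
  qed
  then show ?thesis by (simp add: smooth_def)
qed

lemma C_times_add: "C_times n f \<Longrightarrow> C_times n g \<Longrightarrow> C_times n (\<lambda>x. f x + g x)"
proof (induction n arbitrary: f g)
  case 0
  then show ?case by (auto intro: continuous_intros)
next
  case (Suc n)
  have D: "((\<lambda>x. f x + g x) has_derivative
     (\<lambda>h. frechet_derivative f (at x) h + frechet_derivative g (at x) h)) (at x)" for x
    using Suc.prems by (auto intro!: has_derivative_add simp: frechet_derivative_works[symmetric])
  have "frechet_derivative (\<lambda>x. f x + g x) (at x) h
      = frechet_derivative f (at x) h + frechet_derivative g (at x) h" for x h
    using frechet_derivative_at[OF D] by metis
  then show ?case
    using Suc D[THEN differentiableI] by auto
qed

lemma smooth_add: "smooth f \<Longrightarrow> smooth g \<Longrightarrow> smooth (\<lambda>x. f x + g x)"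
  by (simp add: smooth_def C_times_add)

lemma C_times_scaleR:
  "C_times n f \<Longrightarrow> C_times n g \<Longrightarrow> C_times n (\<lambda>x. f x *\<^sub>R g x)"
proof (induction n arbitrary: f g)
  case 0
  then show ?case by (auto intro: continuous_intros)
next
  case (Suc n)
  have D: "((\<lambda>x. f x *\<^sub>R g x) has_derivative
     (\<lambda>h. f x *\<^sub>R frechet_derivative g (at x) h + frechet_derivative f (at x) h *\<^sub>R g x)) (at x)" for x
    using Suc.prems by (auto intro!: has_derivative_scaleR simp: frechet_derivative_works[symmetric])
  have "frechet_derivative (\<lambda>x. f x *\<^sub>R g x) (at x) h
      = f x *\<^sub>R frechet_derivative g (at x) h + frechet_derivative f (at x) h *\<^sub>R g x" for x h
    using frechet_derivative_at[OF D] by metis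
  moreover have "C_times n f" "C_times n g"
    using Suc.prems C_times_SucD by blast+
  ultimately show ?case
    using Suc D[THEN differentiableI] by (auto intro!: C_times_add)
qed

lemma smooth_scaleR: "smooth f \<Longrightarrow> smooth g \<Longrightarrow> smooth (\<lambda>x. f x *\<^sub>R g x)"
  by (simp add: smooth_def C_times_scaleR)

lemma smooth_mult:
  fixes f g :: "'a::real_normed_vector \<Rightarrow> real"
  shows "smooth f \<Longrightarrow> smooth g \<Longrightarrow> smooth (\<lambda>x. f x * g x)"
  using smooth_scaleR[of f g] by simp

lemma smooth_cmult:
  fixes f :: "'a::real_normed_vector \<Rightarrow> real"
  shows "smooth f \<Longrightarrow> smooth (\<lambda>x. c * f x)"
  by (rule smooth_mult[OF smooth_const])

lemma smooth_diff:
  assumes "smooth f" "smooth g"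
  shows "smooth (\<lambda>x. f x - g x)"
  using smooth_add[OF assms(1) smooth_scaleR[OF smooth_const assms(2), of "-1"]] by simp

lemma dir_deriv_add:
  assumes "smooth f" "smooth g"
  shows "dir_deriv h (\<lambda>z. f z + g z) = (\<lambda>z. dir_deriv h f z + dir_deriv h g z)"
  by (rule ext, subst dir_deriv_eq[OF has_derivative_add[OF
        smooth_has_derivative[OF assms(1)] smooth_has_derivative[OF assms(2)]]])
     (simp add: dir_deriv_def)

lemma dir_deriv_diff:
  assumes "smooth f" "smooth g"
  shows "dir_deriv h (\<lambda>z. f z - g z) = (\<lambda>z. dir_deriv h f z - dir_deriv h g z)"
  by (rule ext, subst dir_deriv_eq[OF has_derivative_diff[OF
        smooth_has_derivative[OF assms(1)] smooth_has_derivative[OF assms(2)]]])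
     (simp add: dir_deriv_def)

lemma dir_deriv_mult:
  fixes f g :: "'a::real_normed_vector \<Rightarrow> real"
  assumes "smooth f" "smooth g"
  shows "dir_deriv h (\<lambda>z. f z * g z) = (\<lambda>z. f z * dir_deriv h g z + dir_deriv h f z * g z)"
  by (rule ext, subst dir_deriv_eq[OF has_derivative_mult[OF
        smooth_has_derivative[OF assms(1)] smooth_has_derivative[OF assms(2)]]])
     (simp add: dir_deriv_def)

lemma dir_deriv_cmult:
  fixes f :: "'a::real_normed_vector \<Rightarrow> real"
  assumes "smooth f"
  shows "dir_deriv h (\<lambda>z. c * f z) = (\<lambda>z. c * dir_deriv h f z)"
  using dir_deriv_mult[OF smooth_const assms] by simp

lemma dir_deriv_bounded_linear:
  assumes "bounded_linear L"
  shows "dir_deriv h L = (\<lambda>z. L h)"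
  using dir_deriv_eq[OF bounded_linear_imp_has_derivative[OF assms]] by (simp add: fun_eq_iff)

lemma linear_dir_deriv: "smooth f \<Longrightarrow> linear (\<lambda>h. dir_deriv h f z)"
  unfolding dir_deriv_def
  using smooth_has_derivative has_derivative_bounded_linear bounded_linear.linear by blast

text \<open>Restriction to a line, so that the mean value theorem for one real variable
  applies.\<close>

lemma smooth_line_has_derivative:
  fixes f :: "'a::real_normed_vector \<Rightarrow> real"
  assumes "smooth f"
  shows "((\<lambda>s. f (z + s *\<^sub>R h)) has_real_derivative dir_deriv h f (z + s *\<^sub>R h)) (at s)"
proof -
  have "((\<lambda>s. f (z + s *\<^sub>R h)) has_derivative
     (\<lambda>ds. frechet_derivative f (at (z + s *\<^sub>R h)) (ds *\<^sub>R h))) (at s)"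
    by (rule has_derivative_compose[where g = f, OF _ smooth_has_derivative[OF assms]])
       (auto intro!: derivative_eq_intros)
  then show ?thesis
    using linear_cmul[OF linear_dir_deriv[OF assms, of "z + s *\<^sub>R h"]]
    by (simp add: has_field_derivative_def dir_deriv_def mult_commute_abs)
qed

text \<open>The second difference is symmetric in \<open>h\<close> and \<open>k\<close>; letting \<open>e\<close> tend to 0 gives Schwarz's theorem.\<close>

lemma dir_deriv_mean_value:
  fixes f :: "'a::real_normed_vector \<Rightarrow> real"
  assumes f: "smooth f" and e: "0 < e"
  obtains \<xi> \<eta> where "0 < \<xi>" "\<xi> < e" "0 < \<eta>" "\<eta> < e"
    "f (z + e *\<^sub>R h + e *\<^sub>R k) - f (z + e *\<^sub>R h) - f (z + e *\<^sub>R k) + f z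
      = e\<^sup>2 * dir_deriv k (dir_deriv h f) (z + \<xi> *\<^sub>R h + \<eta> *\<^sub>R k)"
proof -
  \<comment> \<open>The increment in direction \<open>k\<close> as a function of the displacement in
    direction \<open>h\<close>: its own increment over [0, e] is the second difference.\<close>
  let ?g = "\<lambda>s. f (z + e *\<^sub>R k + s *\<^sub>R h) - f (z + s *\<^sub>R h)"
  have "(?g has_real_derivative
      dir_deriv h f (z + e *\<^sub>R k + s *\<^sub>R h) - dir_deriv h f (z + s *\<^sub>R h)) (at s)" for s
    by (intro DERIV_diff smooth_line_has_derivative f)
  from MVT2[OF e this] obtain \<xi> where \<xi>: "0 < \<xi>" "\<xi> < e" and
    1: "?g e - ?g 0 = e * (dir_deriv h f (z + e *\<^sub>R k + \<xi> *\<^sub>R h) - dir_deriv h f (z + \<xi> *\<^sub>R h))"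
    by (metis diff_zero)
  from MVT2[OF e smooth_line_has_derivative[OF smooth_dir_deriv[OF f]], of h "z + \<xi> *\<^sub>R h" k]
  obtain \<eta> where \<eta>: "0 < \<eta>" "\<eta> < e" and
    2: "dir_deriv h f (z + \<xi> *\<^sub>R h + e *\<^sub>R k) - dir_deriv h f (z + \<xi> *\<^sub>R h)
      = e * dir_deriv k (dir_deriv h f) (z + \<xi> *\<^sub>R h + \<eta> *\<^sub>R k)"
    by (auto simp: add.assoc)
  show thesis
    using 1 2 by (intro that[OF \<xi> \<eta>]) (simp add: algebra_simps power2_eq_square)
qed

lemma dir_deriv_commute:
  fixes f :: "'a::real_normed_vector \<Rightarrow> real"
  assumes f: "smooth f"
  shows "dir_deriv h (dir_deriv k f) = dir_deriv k (dir_deriv h f)"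
proof
  fix z
  define e where "e n = inverse (real (Suc n))" for n
  have e: "e n > 0" for n by (simp add: e_def)
  have e0: "e \<longlonglongrightarrow> 0"
    unfolding e_def using LIMSEQ_inverse_real_of_nat by simp
  have "\<exists>x y x' y'. 0 < x \<and> x < e n \<and> 0 < y \<and> y < e n \<and> 0 < x' \<and> x' < e n \<and> 0 < y' \<and> y' < e n \<and>
     dir_deriv k (dir_deriv h f) (z + x *\<^sub>R h + y *\<^sub>R k)
       = dir_deriv h (dir_deriv k f) (z + x' *\<^sub>R k + y' *\<^sub>R h)" for n
  proof -
    obtain x y where 1: "0 < x" "x < e n" "0 < y" "y < e n"
      "f (z + e n *\<^sub>R h + e n *\<^sub>R k) - f (z + e n *\<^sub>R h) - f (z + e n *\<^sub>R k) + f z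
      = (e n)\<^sup>2 * dir_deriv k (dir_deriv h f) (z + x *\<^sub>R h + y *\<^sub>R k)"
      using dir_deriv_mean_value[OF f e] by blast
    obtain x' y' where 2: "0 < x'" "x' < e n" "0 < y'" "y' < e n"
      "f (z + e n *\<^sub>R k + e n *\<^sub>R h) - f (z + e n *\<^sub>R k) - f (z + e n *\<^sub>R h) + f z
      = (e n)\<^sup>2 * dir_deriv h (dir_deriv k f) (z + x' *\<^sub>R k + y' *\<^sub>R h)"
      using dir_deriv_mean_value[OF f e] by blast
    \<comment> \<open>The two second differences coincide, so both mixed derivatives take the same
      value at two possibly different points near \<open>z\<close>.\<close>
    have "(e n)\<^sup>2 * dir_deriv k (dir_deriv h f) (z + x *\<^sub>R h + y *\<^sub>R k)
        = (e n)\<^sup>2 * dir_deriv h (dir_deriv k f) (z + x' *\<^sub>R k + y' *\<^sub>R h)"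
      using 1(5) 2(5) by (simp add: algebra_simps)
    then show ?thesis using 1 2 e[of n] by auto
  qed
  then obtain x y x' y' where *: "\<And>n. 0 < x n \<and> x n < e n \<and> 0 < y n \<and> y n < e n \<and>
      0 < x' n \<and> x' n < e n \<and> 0 < y' n \<and> y' n < e n"
    and eq: "\<And>n. dir_deriv k (dir_deriv h f) (z + x n *\<^sub>R h + y n *\<^sub>R k)
       = dir_deriv h (dir_deriv k f) (z + x' n *\<^sub>R k + y' n *\<^sub>R h)"
    by metis
  have lim: "u \<longlonglongrightarrow> 0" if "\<And>n. 0 < u n \<and> u n < e n" for u
    by (rule tendsto_sandwich[OF _ _ tendsto_const e0]; intro always_eventually allI less_imp_le; use that in blast)
  have L: "(\<lambda>n. dir_deriv k' (dir_deriv h' f) (z + u n *\<^sub>R h' + v n *\<^sub>R k'))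
      \<longlonglongrightarrow> dir_deriv k' (dir_deriv h' f) z" if "u \<longlonglongrightarrow> 0" "v \<longlonglongrightarrow> 0" for h' k' u v
  proof (rule isCont_tendsto_compose[OF smooth_isCont[OF smooth_dir_deriv[OF smooth_dir_deriv[OF f]]]])
    have "(\<lambda>n. z + u n *\<^sub>R h' + v n *\<^sub>R k') \<longlonglongrightarrow> z + 0 *\<^sub>R h' + 0 *\<^sub>R k'"
      by (intro tendsto_intros that)
    then show "(\<lambda>n. z + u n *\<^sub>R h' + v n *\<^sub>R k') \<longlonglongrightarrow> z" by simp
  qed
  have "(\<lambda>n. dir_deriv k (dir_deriv h f) (z + x n *\<^sub>R h + y n *\<^sub>R k)) \<longlonglongrightarrow> dir_deriv k (dir_deriv h f) z"
    by (rule L; rule lim) (use * in blast)+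
  moreover have "(\<lambda>n. dir_deriv h (dir_deriv k f) (z + x' n *\<^sub>R k + y' n *\<^sub>R h)) \<longlonglongrightarrow> dir_deriv h (dir_deriv k f) z"
    by (rule L; rule lim) (use * in blast)+
  ultimately show "dir_deriv h (dir_deriv k f) z = dir_deriv k (dir_deriv h f) z"
    using LIMSEQ_unique unfolding eq by blast
qed

lemma dir_deriv_divide:
  fixes f :: "'a::real_normed_vector \<Rightarrow> real"
  assumes "smooth f"
  shows "dir_deriv h (\<lambda>z. f z / c) = (\<lambda>z. dir_deriv h f z / c)"
  using dir_deriv_cmult[OF assms, of h "1 / c"] by simp

lemma dir_deriv_minus:
  fixes f :: "'a::real_normed_vector \<Rightarrow> real"
  assumes "smooth f"
  shows "dir_deriv h (\<lambda>z. - f z) = (\<lambda>z. - dir_deriv h f z)"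
  using dir_deriv_cmult[OF assms, of h "- 1"] by simp

lemma smooth_divide:
  fixes f :: "'a::real_normed_vector \<Rightarrow> real"
  shows "smooth f \<Longrightarrow> smooth (\<lambda>z. f z / c)"
  using smooth_cmult[of f "1 / c"] by simp

lemma smooth_sum: "(\<And>i. i \<in> A \<Longrightarrow> smooth (f i)) \<Longrightarrow> smooth (\<lambda>x. \<Sum>i\<in>A. f i x)"
  by (induction A rule: infinite_finite_induct) (simp_all add: smooth_const smooth_add)

lemma smooth_minus:
  fixes f :: "'a::real_normed_vector \<Rightarrow> real"
  shows "smooth f \<Longrightarrow> smooth (\<lambda>z. - f z)"
  using smooth_cmult[of f "- 1"] by simp

lemma dir_deriv_bounded_linear_comp:
  assumes "bounded_linear L" "smooth X"
  shows "dir_deriv h (\<lambda>z. L (X z)) z = L (dir_deriv h X z)"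
  by (subst dir_deriv_eq[OF bounded_linear.has_derivative[OF assms(1) smooth_has_derivative[OF assms(2)]]])
     (simp add: dir_deriv_def)

section \<open>Prolongations\<close>

lemma bounded_linear_nth_snd: "bounded_linear (\<lambda>z. snd z $ J)"
  by (intro bounded_linear_compose[OF bounded_linear_vec_nth] bounded_linear_snd)

lemma bounded_linear_nth_fst: "bounded_linear (\<lambda>z. fst z $ J)"
  by (intro bounded_linear_compose[OF bounded_linear_vec_nth] bounded_linear_fst)

abbreviation d_indep :: "'p \<Rightarrow> (('p::finite, 'q::finite) jet0 \<Rightarrow> real) \<Rightarrow> ('p, 'q) jet0 \<Rightarrow> real" where
  "d_indep i F \<equiv> dir_deriv (axis i 1, 0) F"

abbreviation d_dep :: "'q \<Rightarrow> (('p::finite, 'q::finite) jet0 \<Rightarrow> real) \<Rightarrow> ('p, 'q) jet0 \<Rightarrow> real" where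
  "d_dep J F \<equiv> dir_deriv (0, axis J 1) F"

lemma bounded_linear_nth_nth_snd: "bounded_linear (\<lambda>j. snd j $ J $ i)"
  by (intro bounded_linear_compose[OF bounded_linear_vec_nth] bounded_linear_snd)

text \<open>Linearity of the derivative, applied to the lifted coordinate direction. This makes the
  symmetry condition polynomial in the jet coordinates, with coefficients that are functions on the
  0-jets.\<close>

lemma total_D0_expand:
  fixes F :: "('p::finite, 'q::finite) jet0 \<Rightarrow> real"
  assumes "smooth F"
  shows "total_D0 i F j = d_indep i F (fst j) + (\<Sum>J\<in>UNIV. snd j $ J $ i * d_dep J F (fst j))"
proof -
  have "((axis i 1, \<chi> J. snd j $ J $ i) :: ('p, 'q) jet0) = (axis i 1, 0) + (\<Sum>J\<in>UNIV. (snd j $ J $ i) *\<^sub>R (0, axis J 1))"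
    by (auto simp: prod_eq_iff fst_sum snd_sum vec_eq_iff axis_def if_distrib[of "\<lambda>x. _ * x"]
        sum.delta' cong: if_cong)
  moreover have lin: "linear (frechet_derivative F (at (fst j)))"
    using linear_dir_deriv[OF assms] by (simp add: dir_deriv_def)
  ultimately show ?thesis
    unfolding total_D0_def dir_deriv_def
    by (simp only: linear_add[OF lin] linear_sum[OF lin] linear_cmul[OF lin] real_scaleR_def)
qed

text \<open>The part of the iterated total derivative in directions \<open>i\<close> and
  \<open>k\<close> that is free of second-order jet coordinates.\<close>

definition second_total :: "'p \<Rightarrow> 'p \<Rightarrow> (('p::finite, 'q::finite) jet0 \<Rightarrow> real) \<Rightarrow> ('p, 'q) jet1 \<Rightarrow> real" where
  "second_total i k F j = total_D0 k (d_indep i F) j + (\<Sum>J\<in>UNIV. snd j $ J $ i * total_D0 k (d_dep J F) j)"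

lemma total_D0_has_derivative:
  fixes F :: "('p::finite, 'q::finite) jet0 \<Rightarrow> real"
  assumes F: "smooth F"
  shows "(total_D0 i F has_derivative (\<lambda>h. frechet_derivative (d_indep i F) (at (fst j)) (fst h) +
     (\<Sum>J\<in>UNIV. snd j $ J $ i * frechet_derivative (d_dep J F) (at (fst j)) (fst h)
        + snd h $ J $ i * d_dep J F (fst j)))) (at j)"
proof -
  have comp: "((\<lambda>j. G (fst j)) has_derivative (\<lambda>h. frechet_derivative G (at (fst j)) (fst h))) (at j)"
    if "smooth G" for G :: "('p, 'q) jet0 \<Rightarrow> real"
    by (rule has_derivative_compose[OF has_derivative_fst[OF has_derivative_ident]
          smooth_has_derivative[OF that]])
  have nth: "((\<lambda>j. snd j $ J $ i) has_derivative (\<lambda>h. snd h $ J $ i)) (at j)" for J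
    by (rule bounded_linear_imp_has_derivative[OF bounded_linear_nth_nth_snd])
  have eq: "total_D0 i F = (\<lambda>j. d_indep i F (fst j) + (\<Sum>J\<in>UNIV. snd j $ J $ i * d_dep J F (fst j)))"
    by (rule ext) (rule total_D0_expand[OF F])
  show ?thesis
    unfolding eq
    by (intro has_derivative_add has_derivative_sum has_derivative_mult comp nth smooth_dir_deriv F)
qed

text \<open>A first total derivative is affine in the first-order coordinates, so second-order ones
  enter linearly, through the derivative of \<open>snd j $ J $ i\<close>.\<close>

lemma total_D1_total_D0:
  fixes F :: "('p::finite, 'q::finite) jet0 \<Rightarrow> real"
  assumes F: "smooth F"
  shows "total_D1 k (total_D0 i F) j =
    second_total i k F (fst j) + (\<Sum>J\<in>UNIV. snd j $ J $ i $ k * d_dep J F (fst (fst j)))"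
  unfolding total_D1_def second_total_def frechet_derivative_at[OF total_D0_has_derivative[OF F], symmetric]
  by (simp add: total_D0_def sum.distrib)

lemma prolong_coeff2_expand:
  fixes X :: "('p::finite, 'q::finite) jet0 \<Rightarrow> ('p, 'q) jet0"
  assumes \<xi>: "\<And>l. smooth (\<lambda>z. fst (X z) $ l)" and \<eta>: "\<And>J. smooth (\<lambda>z. snd (X z) $ J)"
  shows "prolong_coeff2 X j $ J $ i $ k =
     total_D1 k (total_D0 i (\<lambda>z. snd (X z) $ J)) j
     - (\<Sum>l\<in>UNIV. total_D1 k (total_D0 i (\<lambda>z. fst (X z) $ l)) j * snd (fst j) $ J $ l
          + total_D0 i (\<lambda>z. fst (X z) $ l) (fst j) * snd j $ J $ l $ k)
     - (\<Sum>l\<in>UNIV. total_D0 k (\<lambda>z. fst (X z) $ l) (fst j) * snd j $ J $ i $ l)"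
proof -
  let ?\<xi> = "\<lambda>l z. fst (X z) $ l" and ?\<eta> = "\<lambda>z. snd (X z) $ J"
  have D: "(total_D0 i F has_derivative frechet_derivative (total_D0 i F) (at (fst j))) (at (fst j))"
    if "smooth F" for F :: "('p, 'q) jet0 \<Rightarrow> real"
    using differentiableI[OF total_D0_has_derivative[OF that]] frechet_derivative_works by blast
  have nth: "((\<lambda>j. snd j $ J $ l) has_derivative (\<lambda>h. snd h $ J $ l)) (at (fst j))" for l
    by (rule bounded_linear_imp_has_derivative[OF bounded_linear_nth_nth_snd])
  have "((\<lambda>j'. prolong_coeff1 X j' $ J $ i) has_derivative
      (\<lambda>h. frechet_derivative (total_D0 i ?\<eta>) (at (fst j)) h -
        (\<Sum>l\<in>UNIV. total_D0 i (?\<xi> l) (fst j) * snd h $ J $ l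
           + frechet_derivative (total_D0 i (?\<xi> l)) (at (fst j)) h * snd (fst j) $ J $ l))) (at (fst j))"
    unfolding prolong_coeff1_def vec_lambda_beta
    by (intro has_derivative_diff has_derivative_sum has_derivative_mult D nth \<xi> \<eta>)
  from fun_cong[OF frechet_derivative_at[OF this],
      of "((axis k 1, \<chi> J. snd (fst j) $ J $ k), \<chi> J l. snd j $ J $ l $ k)"]
  have "total_D1 k (\<lambda>j'. prolong_coeff1 X j' $ J $ i) j = total_D1 k (total_D0 i ?\<eta>) j
     - (\<Sum>l\<in>UNIV. total_D1 k (total_D0 i (?\<xi> l)) j * snd (fst j) $ J $ l
          + total_D0 i (?\<xi> l) (fst j) * snd j $ J $ l $ k)"
    by (simp add: total_D1_def add.commute)
  then show ?thesis
    by (simp add: prolong_coeff2_def)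
qed

lemma total_D0_bounded_linear:
  assumes "bounded_linear F"
  shows "total_D0 i F j = F (axis i 1, \<chi> J. snd j $ J $ i)"
  by (simp add: total_D0_def frechet_derivative_at[OF bounded_linear_imp_has_derivative[OF assms], symmetric])

lemma total_D1_bounded_linear:
  assumes "bounded_linear F"
  shows "total_D1 i F j = F ((axis i 1, \<chi> J. snd (fst j) $ J $ i), \<chi> J k. snd j $ J $ k $ i)"
  by (simp add: total_D1_def frechet_derivative_at[OF bounded_linear_imp_has_derivative[OF assms], symmetric])

lemma smooth_components:
  fixes X :: "('p::finite, 'q::finite) jet0 \<Rightarrow> ('p, 'q) jet0"
  assumes "smooth X"
  shows "smooth (\<lambda>z. fst (X z) $ l)" "smooth (\<lambda>z. snd (X z) $ J)"
  using smooth_bounded_linear_comp[OF bounded_linear_nth_fst assms]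
    smooth_bounded_linear_comp[OF bounded_linear_nth_snd assms] by auto

lemma dir_deriv_eq_sum:
  fixes F :: "('p::finite, 'q::finite) jet0 \<Rightarrow> real"
  assumes "smooth F"
  shows "dir_deriv h F z =
    (\<Sum>i\<in>UNIV. fst h $ i * d_indep i F z) + (\<Sum>J\<in>UNIV. snd h $ J * d_dep J F z)"
proof -
  have "h = (\<Sum>i\<in>UNIV. (fst h $ i) *\<^sub>R (axis i 1, 0)) + (\<Sum>J\<in>UNIV. (snd h $ J) *\<^sub>R (0, axis J 1))"
    by (auto simp: prod_eq_iff fst_sum snd_sum vec_eq_iff axis_def if_distrib[of "\<lambda>x. _ * x"]
        sum.delta' cong: if_cong)
  then have "dir_deriv h F z = dir_deriv ((\<Sum>i\<in>UNIV. (fst h $ i) *\<^sub>R (axis i 1, 0))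
     + (\<Sum>J\<in>UNIV. (snd h $ J) *\<^sub>R (0, axis J 1))) F z"
    by simp
  then show ?thesis
    by (simp only: linear_add[OF linear_dir_deriv[OF assms]] linear_sum[OF linear_dir_deriv[OF assms]]
        linear_cmul[OF linear_dir_deriv[OF assms]] real_scaleR_def)
qed

lemma constant_if_partials_zero:
  fixes F :: "('p::finite, 'q::finite) jet0 \<Rightarrow> real"
  assumes F: "smooth F" and "\<And>i z. d_indep i F z = 0" "\<And>J z. d_dep J F z = 0"
  shows "F z = F 0"
proof -
  have "(F has_derivative (\<lambda>h. 0)) (at x)" for x
  proof -
    have "frechet_derivative F (at x) = (\<lambda>h. 0)"
      using dir_deriv_eq_sum[OF F, of _ x] assms(2,3) by (simp add: dir_deriv_def fun_eq_iff)
    then show ?thesis using smooth_has_derivative[OF F, of x] by simp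
  qed
  then show ?thesis
    using has_derivative_zero_unique[of UNIV F z 0] by auto
qed

text \<open>Differentiating in the coordinate recovers the points where it vanishes.\<close>

lemma coord_mult_zeroD:
  fixes F :: "('p::finite, 'q::finite) jet0 \<Rightarrow> real"
  assumes F: "smooth F" "\<And>z. d_dep J F z = 0" and 0: "\<And>z. snd z $ J * F z = 0"
  shows "F z = 0"
proof -
  have "d_dep J (\<lambda>z. snd z $ J * F z) z = F z"
    using dir_deriv_mult[OF smooth_bounded_linear[OF bounded_linear_nth_snd] F(1)] F(2)
    by (simp add: dir_deriv_bounded_linear[OF bounded_linear_nth_snd] axis_def)
  then show ?thesis unfolding 0 by simp
qed

lemma smooth_if_components:
  fixes X :: "('p::finite, 'q::finite) jet0 \<Rightarrow> ('p, 'q) jet0"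
  assumes "\<And>l. smooth (\<lambda>z. fst (X z) $ l)" "\<And>J. smooth (\<lambda>z. snd (X z) $ J)"
  shows "smooth X"
proof -
  have "X = (\<lambda>z. (\<Sum>i\<in>UNIV. (fst (X z) $ i) *\<^sub>R (axis i 1, 0)) + (\<Sum>J\<in>UNIV. (snd (X z) $ J) *\<^sub>R (0, axis J 1)))"
    by (auto simp: prod_eq_iff fst_sum snd_sum vec_eq_iff axis_def if_distrib[of "\<lambda>x. _ * x"]
        sum.delta' fun_eq_iff cong: if_cong)
  moreover have "smooth \<dots>"
    by (intro smooth_add smooth_sum smooth_scaleR smooth_const assms)
  ultimately show ?thesis by simp
qed

text \<open>Sorted by \<open>r\<close>: first the terms without it, then those coupling different
  dependent variables, then those in which the Jacobian of the independent components acts on the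
  two derivative indices.\<close>

lemma prolong_coeff2_second_total:
  fixes X :: "('p::finite, 'q::finite) jet0 \<Rightarrow> ('p, 'q) jet0"
  assumes \<xi>: "\<And>l. smooth (\<lambda>z. fst (X z) $ l)" and \<eta>: "\<And>J. smooth (\<lambda>z. snd (X z) $ J)"
  shows "prolong_coeff2 X ((z, p), r) $ J $ i $ k =
     second_total i k (\<lambda>z. snd (X z) $ J) (z, p)
     - (\<Sum>l\<in>UNIV. second_total i k (\<lambda>z. fst (X z) $ l) (z, p) * p $ J $ l)
     + (\<Sum>K\<in>UNIV. r $ K $ i $ k * (d_dep K (\<lambda>z. snd (X z) $ J) z
          - (\<Sum>l\<in>UNIV. d_dep K (\<lambda>z. fst (X z) $ l) z * p $ J $ l)))
     - (\<Sum>l\<in>UNIV. total_D0 i (\<lambda>z. fst (X z) $ l) (z, p) * r $ J $ l $ k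
          + total_D0 k (\<lambda>z. fst (X z) $ l) (z, p) * r $ J $ i $ l)"
proof -
  let ?f = "\<lambda>l z. fst (X z) $ l"
  have "(\<Sum>K\<in>UNIV. r $ K $ i $ k * (\<Sum>l\<in>UNIV. d_dep K (?f l) z * p $ J $ l)) =
        (\<Sum>l\<in>UNIV. (\<Sum>K\<in>UNIV. r $ K $ i $ k * d_dep K (?f l) z) * p $ J $ l)"
    unfolding sum_distrib_left sum_distrib_right by (subst sum.swap) (simp add: mult.assoc)
  then show ?thesis
    unfolding prolong_coeff2_expand[of X, OF \<xi> \<eta>]
    by (simp add: total_D1_total_D0 \<xi> \<eta> algebra_simps sum.distrib sum_subtractf)
qed

lemma second_total_expand:
  fixes F :: "('p::finite, 'q::finite) jet0 \<Rightarrow> real"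
  assumes F: "smooth F"
  shows "second_total i k F (z, p) = d_indep k (d_indep i F) z
    + (\<Sum>J\<in>UNIV. p $ J $ k * d_indep i (d_dep J F) z) + (\<Sum>J\<in>UNIV. p $ J $ i * d_indep k (d_dep J F) z)
    + (\<Sum>J\<in>UNIV. \<Sum>K\<in>UNIV. p $ J $ i * p $ K $ k * d_dep K (d_dep J F) z)"
  unfolding second_total_def
  by (simp add: total_D0_expand smooth_dir_deriv F dir_deriv_commute[OF F, of "(0, _)" "(_, 0)"]
      sum_distrib_left distrib_left sum.distrib mult.assoc)

lemma d_dep_coord: "d_dep J (\<lambda>z. snd z $ K) = (\<lambda>z. if J = K then 1 else 0)"
  by (simp add: dir_deriv_bounded_linear[OF bounded_linear_nth_snd] axis_def)

lemma d_indep_coord: "d_indep i (\<lambda>z. snd z $ K) = (\<lambda>z. 0)"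
  by (simp add: dir_deriv_bounded_linear[OF bounded_linear_nth_snd])

lemma smooth_coord: "smooth (\<lambda>z. snd z $ K)"
  by (rule smooth_bounded_linear[OF bounded_linear_nth_snd])

section \<open>The system in jet coordinates\<close>

lemma bounded_linear_psi: "bounded_linear psi"
  unfolding linear_conv_bounded_linear[symmetric] psi_def coord_u_def coord_v_def
  by (rule linearI) (simp_all add: complex_eq_iff)

lemma bounded_linear_phi: "bounded_linear phi"
  unfolding phi_def by (intro bounded_linear_compose[OF bounded_linear_vec_nth] bounded_linear_snd)

lemma total_D0_psi: "total_D0 i psi = (\<lambda>j. Complex (snd j $ 1 $ i) (snd j $ 2 $ i))"
  by (rule ext, subst total_D0_bounded_linear[OF bounded_linear_psi])
     (simp add: psi_def coord_u_def coord_v_def)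

lemma total_D0_phi: "total_D0 i phi = (\<lambda>j. snd j $ 3 $ i)"
  by (rule ext, subst total_D0_bounded_linear[OF bounded_linear_phi]) (simp add: phi_def)

lemma total_D1_D0_psi:
  "total_D1 k (total_D0 i psi) j = Complex (snd j $ 1 $ i $ k) (snd j $ 2 $ i $ k)"
proof -
  have "bounded_linear (total_D0 i psi)"
    unfolding total_D0_psi linear_conv_bounded_linear[symmetric]
    by (rule linearI) (simp_all add: complex_eq_iff)
  then show ?thesis
    by (subst total_D1_bounded_linear) (simp_all add: total_D0_psi)
qed

lemma total_D1_D0_phi: "total_D1 k (total_D0 i phi) j = snd j $ 3 $ i $ k"
proof -
  have "bounded_linear (total_D0 i phi)"
    unfolding total_D0_phi by (rule bounded_linear_nth_nth_snd)
  then show ?thesis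
    by (subst total_D1_bounded_linear) (simp_all add: total_D0_phi)
qed

text \<open>The squared modulus is quadratic in (u, v), so the shortcut for bounded linear maps that
  serves \<open>psi\<close> and \<open>phi\<close> is replaced by the general expansion.\<close>

lemma total_D1_D0_cmod_psi:
  "total_D1 i (total_D0 i (\<lambda>z. (cmod (psi z))\<^sup>2)) j =
     2 * ((snd (fst j) $ 1 $ i)\<^sup>2 + (snd (fst j) $ 2 $ i)\<^sup>2
        + snd (fst (fst j)) $ 1 * snd j $ 1 $ i $ i + snd (fst (fst j)) $ 2 * snd j $ 2 $ i $ i)"
proof -
  let ?F = "\<lambda>z::point. snd z $ 1 * snd z $ 1 + snd z $ 2 * snd z $ 2"
  have eq: "(\<lambda>z. (cmod (psi z))\<^sup>2) = ?F"
    by (simp add: psi_def cmod_def coord_u_def coord_v_def power2_eq_square fun_eq_iff)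
  have lin: "smooth (\<lambda>z::point. snd z $ J)" for J
    by (intro smooth_bounded_linear bounded_linear_nth_snd)
  have sm: "smooth ?F" by (intro smooth_add smooth_mult lin)
  have d: "dir_deriv h ?F = (\<lambda>z. 2 * (snd h $ 1 * snd z $ 1) + 2 * (snd h $ 2 * snd z $ 2))" for h
    by (simp add: dir_deriv_add dir_deriv_mult smooth_mult lin
        dir_deriv_bounded_linear[OF bounded_linear_nth_snd] fun_eq_iff)
  have dd: "dir_deriv k (dir_deriv h ?F) = (\<lambda>z. 2 * (snd h $ 1 * snd k $ 1) + 2 * (snd h $ 2 * snd k $ 2))"
    for h k
    unfolding d
    by (simp add: dir_deriv_add dir_deriv_cmult smooth_cmult lin
        dir_deriv_bounded_linear[OF bounded_linear_nth_snd] fun_eq_iff)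
  show ?thesis
    unfolding eq total_D1_total_D0[OF sm] second_total_def
      total_D0_expand[OF smooth_dir_deriv[OF sm]] dd unfolding d
    by (simp add: sum_3 axis_def power2_eq_square algebra_simps)
qed

lemma pde_system_eq:
  "pde_system a a1 a2 a3 a4 a5 b w m d =
   (\<lambda>j. let u = snd (fst (fst j)) $ 1; v = snd (fst (fst j)) $ 2; \<phi> = snd (fst (fst j)) $ 3;
         p = snd (fst j); r = snd j in
     (a * r $ 1 $ 1 $ 1 + a2 * r $ 1 $ 2 $ 2 + a3 * r $ 1 $ 3 $ 3 + a4 * r $ 1 $ 3 $ 2
        - a1 * p $ 2 $ 3 - a5 * p $ 2 $ 2 - ((b - w * m) * (u * u + v * v) * u - w * u * \<phi>),
      a * r $ 2 $ 1 $ 1 + a2 * r $ 2 $ 2 $ 2 + a3 * r $ 2 $ 3 $ 3 + a4 * r $ 2 $ 3 $ 2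
        + a1 * p $ 1 $ 3 + a5 * p $ 1 $ 2 - ((b - w * m) * (u * u + v * v) * v - w * v * \<phi>),
      r $ 3 $ 1 $ 1 + 1 / (d\<^sup>2 - m) * (r $ 3 $ 2 $ 2 - r $ 3 $ 3 $ 3)
        - 2 * (p $ 1 $ 2 * p $ 1 $ 2 + p $ 2 $ 2 * p $ 2 $ 2 + u * r $ 1 $ 2 $ 2 + v * r $ 2 $ 2 $ 2)))"
  unfolding pde_system_def psi_residual_def phi_residual_def Let_def
    total_D1_D0_psi total_D1_D0_phi total_D1_D0_cmod_psi
  by (rule ext)
     (simp add: total_D0_psi psi_def phi_def coord_u_def coord_v_def
        cmod_def power2_eq_square algebra_simps)

lemma frechet_derivative_pde_system:
  "frechet_derivative (pde_system a a1 a2 a3 a4 a5 b w m d) (at j) h =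
   (let u = snd (fst (fst j)) $ 1; v = snd (fst (fst j)) $ 2; \<phi> = snd (fst (fst j)) $ 3; p = snd (fst j);
        r = snd j; u' = snd (fst (fst h)) $ 1; v' = snd (fst (fst h)) $ 2; \<phi>' = snd (fst (fst h)) $ 3;
        p' = snd (fst h); r' = snd h in
     (a * r' $ 1 $ 1 $ 1 + a2 * r' $ 1 $ 2 $ 2 + a3 * r' $ 1 $ 3 $ 3 + a4 * r' $ 1 $ 3 $ 2
        - a1 * p' $ 2 $ 3 - a5 * p' $ 2 $ 2
        - ((b - w * m) * ((3 * u * u + v * v) * u' + 2 * u * v * v') - w * (u * \<phi>' + u' * \<phi>)),
      a * r' $ 2 $ 1 $ 1 + a2 * r' $ 2 $ 2 $ 2 + a3 * r' $ 2 $ 3 $ 3 + a4 * r' $ 2 $ 3 $ 2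
        + a1 * p' $ 1 $ 3 + a5 * p' $ 1 $ 2
        - ((b - w * m) * ((u * u + 3 * v * v) * v' + 2 * u * v * u') - w * (v * \<phi>' + v' * \<phi>)),
      r' $ 3 $ 1 $ 1 + 1 / (d\<^sup>2 - m) * (r' $ 3 $ 2 $ 2 - r' $ 3 $ 3 $ 3)
        - 2 * (2 * p $ 1 $ 2 * p' $ 1 $ 2 + 2 * p $ 2 $ 2 * p' $ 2 $ 2
             + u * r' $ 1 $ 2 $ 2 + u' * r $ 1 $ 2 $ 2 + v * r' $ 2 $ 2 $ 2 + v' * r $ 2 $ 2 $ 2)))"
proof -
  have z: "((\<lambda>j::(3,3) jet2. snd (fst (fst j)) $ J) has_derivative (\<lambda>h. snd (fst (fst h)) $ J)) (at j)" for J
    by (intro bounded_linear_imp_has_derivative bounded_linear_compose[OF bounded_linear_vec_nth]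
        bounded_linear_snd_comp bounded_linear_fst_comp bounded_linear_ident)
  have p: "((\<lambda>j::(3,3) jet2. snd (fst j) $ J $ i) has_derivative (\<lambda>h. snd (fst h) $ J $ i)) (at j)" for J i
    by (intro bounded_linear_imp_has_derivative bounded_linear_compose[OF bounded_linear_vec_nth]
        bounded_linear_snd_comp bounded_linear_fst_comp bounded_linear_ident)
  have r: "((\<lambda>j::(3,3) jet2. snd j $ J $ i $ k) has_derivative (\<lambda>h. snd h $ J $ i $ k)) (at j)" for J i k
    by (intro bounded_linear_imp_has_derivative bounded_linear_compose[OF bounded_linear_vec_nth]
        bounded_linear_snd_comp bounded_linear_fst_comp bounded_linear_ident)
  show ?thesis
    unfolding pde_system_eq Let_def
    by (subst frechet_derivative_at[symmetric],
        (rule has_derivative_Pair has_derivative_add has_derivative_diff has_derivative_mult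
          has_derivative_const z p r)+)
       (simp add: algebra_simps)
qed

locale dispersive_system =
  fixes a b c e0 d m w a1 a2 a3 a4 a5 :: real
  assumes a: "a \<noteq> 0" and e0: "e0 > 0" and d: "d > 0" and m: "m > 0" and w: "w > 0"
    and md: "m \<noteq> d\<^sup>2"
    and a1: "a1 = (d - m * c) / ((d\<^sup>2 - m) * sqrt m)"
    and a2: "a2 = e0 * d\<^sup>2 / (d\<^sup>2 - m)\<^sup>2"
    and a3: "a3 = e0 * m / (d\<^sup>2 - m)\<^sup>2"
    and a4: "a4 = - (2 * e0 * d * sqrt m / (d\<^sup>2 - m)\<^sup>2)"
    and a5: "a5 = (d * c - 1) / (d\<^sup>2 - m)"
begin

abbreviation "pde \<equiv> pde_system a a1 a2 a3 a4 a5 b w m d"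

definition \<mu> :: real where "\<mu> = sqrt m"
definition \<kappa> :: real where "\<kappa> = 1 / (d\<^sup>2 - m)"
definition e :: real where "e = e0 / (d\<^sup>2 - m)\<^sup>2"

lemma mu: "\<mu> > 0" "\<mu> * \<mu> = m"
  using m by (simp_all add: \<mu>_def)

lemma e_pos: "e > 0"
  using e0 md by (simp add: e_def)

lemma kappa: "\<kappa> \<noteq> 0" "d * d \<noteq> \<mu> * \<mu>"
  using md mu(2) by (auto simp: \<kappa>_def power2_eq_square)

text \<open>The coefficients of \<open>e\<close> times the square of
  \<open>d * q - \<mu> * r\<close>; the symbol is thus degenerate in the (y, t)-plane.\<close>

lemma a234: "a2 = e * d * d" "a3 = e * \<mu> * \<mu>" "a4 = - 2 * e * d * \<mu>"
  using m by (simp_all add: a2 a3 a4 e_def \<mu>_def power2_eq_square)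

lemma a24: "a2 \<noteq> 0" "a4 \<noteq> 0"
  using e_pos d mu(1) by (simp_all add: a234)

text \<open>The first-order part of the equation for \<open>\<psi>\<close> is transversal to the direction of its
  second-order part in the \<open>(y, t)\<close>-plane.\<close>

lemma transversal: "a1 * d + a5 * \<mu> = 1 / \<mu>"
proof -
  have *: "(d - x\<^sup>2 * c) / (N * x) * d + (d * c - 1) / N * x = (d\<^sup>2 - x\<^sup>2) / (N * x)"
    if "x \<noteq> 0" "N \<noteq> 0" for x N :: real
    using that by (simp add: divide_simps) (simp add: algebra_simps power2_eq_square)
  show ?thesis
    using *[of \<mu> "d\<^sup>2 - m"] m md by (simp add: a1 a5 \<mu>_def)
qed

lemma symmetry_iff:
  "X \<in> lie_symmetry_algebra pde \<longleftrightarrow> smooth X \<and>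
   (\<forall>z p r. (\<forall>J i k. r $ J $ i $ k = r $ J $ k $ i) \<longrightarrow>
     (let u = snd z $ 1; v = snd z $ 2; \<phi> = snd z $ 3 in
       a * r $ 1 $ 1 $ 1 + a2 * r $ 1 $ 2 $ 2 + a3 * r $ 1 $ 3 $ 3 + a4 * r $ 1 $ 3 $ 2
         = a1 * p $ 2 $ 3 + a5 * p $ 2 $ 2 + ((b - w * m) * (u * u + v * v) * u - w * u * \<phi>) \<longrightarrow>
       a * r $ 2 $ 1 $ 1 + a2 * r $ 2 $ 2 $ 2 + a3 * r $ 2 $ 3 $ 3 + a4 * r $ 2 $ 3 $ 2
         = - a1 * p $ 1 $ 3 - a5 * p $ 1 $ 2 + ((b - w * m) * (u * u + v * v) * v - w * v * \<phi>) \<longrightarrow>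
       r $ 3 $ 1 $ 1 + \<kappa> * (r $ 3 $ 2 $ 2 - r $ 3 $ 3 $ 3)
         = 2 * (p $ 1 $ 2 * p $ 1 $ 2 + p $ 2 $ 2 * p $ 2 $ 2 + u * r $ 1 $ 2 $ 2 + v * r $ 2 $ 2 $ 2) \<longrightarrow>
      (let u' = snd (X z) $ 1; v' = snd (X z) $ 2; \<phi>' = snd (X z) $ 3;
           p' = prolong_coeff1 X (z, p); r' = prolong_coeff2 X ((z, p), r) in
       a * r' $ 1 $ 1 $ 1 + a2 * r' $ 1 $ 2 $ 2 + a3 * r' $ 1 $ 3 $ 3 + a4 * r' $ 1 $ 3 $ 2
         = a1 * p' $ 2 $ 3 + a5 * p' $ 2 $ 2
         + ((b - w * m) * ((3 * u * u + v * v) * u' + 2 * u * v * v') - w * (u * \<phi>' + u' * \<phi>)) \<and>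
       a * r' $ 2 $ 1 $ 1 + a2 * r' $ 2 $ 2 $ 2 + a3 * r' $ 2 $ 3 $ 3 + a4 * r' $ 2 $ 3 $ 2
         = - a1 * p' $ 1 $ 3 - a5 * p' $ 1 $ 2
         + ((b - w * m) * ((u * u + 3 * v * v) * v' + 2 * u * v * u') - w * (v * \<phi>' + v' * \<phi>)) \<and>
       r' $ 3 $ 1 $ 1 + \<kappa> * (r' $ 3 $ 2 $ 2 - r' $ 3 $ 3 $ 3)
         = 2 * (2 * p $ 1 $ 2 * p' $ 1 $ 2 + 2 * p $ 2 $ 2 * p' $ 2 $ 2
             + u * r' $ 1 $ 2 $ 2 + u' * r $ 1 $ 2 $ 2 + v * r' $ 2 $ 2 $ 2 + v' * r $ 2 $ 2 $ 2))))"
proof -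
  have eq: "(A1, A2, A3) = (0::real \<times> real \<times> real) \<longleftrightarrow> A1 = 0 \<and> A2 = 0 \<and> A3 = 0" for A1 A2 A3
    by (simp add: prod_eq_iff)
  show ?thesis
    unfolding lie_symmetry_algebra_def jet2_space_def mem_Collect_eq Ball_def split_paired_All
      frechet_derivative_pde_system unfolding pde_system_eq Let_def prolong2_def fst_conv snd_conv eq \<kappa>_def
    by (simp only: imp_conjL diff_eq_eq diff_0 add_0_left mult_1)
       (simp add: algebra_simps)
qed

subsection \<open>Functions of the phase variable\<close>

text \<open>\<open>travelling F\<close> encodes that \<open>F\<close> is a function of \<open>d * t + \<mu> * y\<close> alone, and \<open>D F\<close> is then
  its derivative in this variable.\<close>

definition travelling :: "(point \<Rightarrow> real) \<Rightarrow> bool" where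
  "travelling F \<longleftrightarrow> smooth F \<and> (\<forall>K. d_dep K F = (\<lambda>z. 0)) \<and> d_indep 1 F = (\<lambda>z. 0)
     \<and> (\<forall>z. d * d_indep 2 F z = \<mu> * d_indep 3 F z)"

definition D :: "(point \<Rightarrow> real) \<Rightarrow> point \<Rightarrow> real" where
  "D F = (\<lambda>z. d_indep 3 F z / d)"

lemma travelling_partials:
  assumes "travelling F"
  shows "smooth F" "d_dep K F = (\<lambda>z. 0)" "d_indep 1 F = (\<lambda>z. 0)"
    "d_indep 2 F = (\<lambda>z. \<mu> * D F z)" "d_indep 3 F = (\<lambda>z. d * D F z)"
  using assms d by (auto simp: travelling_def D_def fun_eq_iff field_simps)

text \<open>The defining partial derivatives commute with the t-derivative that \<open>D\<close> is
  made of.\<close>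

lemma travelling_D:
  assumes "travelling F"
  shows "travelling (D F)"
proof -
  note F = travelling_partials[OF assms]
  have sm: "smooth (D F)"
    unfolding D_def by (intro smooth_divide smooth_dir_deriv F)
  have "d_dep K (D F) = (\<lambda>z. 0)" "d_indep 1 (D F) = (\<lambda>z. 0)" for K
    using dir_deriv_commute[OF F(1), of "(0, axis K 1)" "(axis 3 1, 0)"]
      dir_deriv_commute[OF F(1), of "(axis 1 1, 0)" "(axis 3 1, 0)"]
    unfolding D_def by (simp_all add: dir_deriv_divide smooth_dir_deriv F(1-3))
  moreover have "d * d_indep 2 (D F) z = \<mu> * d_indep 3 (D F) z" for z
    using fun_cong[OF dir_deriv_commute[OF F(1), of "(axis 2 1, 0)" "(axis 3 1, 0)"], of z]
    by (simp add: F(4,5) dir_deriv_cmult sm)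
  ultimately show ?thesis
    using sm by (simp add: travelling_def)
qed

text \<open>The gradient of a travelling function is a multiple of (\<mu>, d), on which the perfect
  square of \<open>a234\<close> vanishes; the same holds for its second derivatives.\<close>

lemma travelling_second_order:
  assumes "travelling F"
  shows "d_indep i (d_indep 1 F) z = 0"
    "a2 * d_indep 2 (d_indep 2 F) z + a3 * d_indep 3 (d_indep 3 F) z + a4 * d_indep 2 (d_indep 3 F) z = 0"
  using travelling_partials[OF assms] travelling_partials[OF travelling_D[OF assms]]
  by (simp_all add: dir_deriv_cmult a234)

lemma travelling_first_order:
  assumes "travelling F"
  shows "a1 * d_indep 3 F z + a5 * d_indep 2 F z = D F z / \<mu>"
proof -
  have "a1 * d_indep 3 F z + a5 * d_indep 2 F z = (a1 * d + a5 * \<mu>) * D F z"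
    using travelling_partials[OF assms] by (simp add: algebra_simps)
  then show ?thesis by (simp add: transversal)
qed

lemma travelling_constant:
  assumes "travelling F" "\<And>z. D F z = 0"
  shows "F z = F 0"
  by (rule constant_if_partials_zero)
    (use travelling_partials[OF assms(1)] assms(2) exhaust_3 in \<open>auto, metis\<close>)

definition s :: "point \<Rightarrow> real" where "s z = d * fst z $ 3 + \<mu> * fst z $ 2"

lemma smooth_s: "smooth s"
  unfolding s_def by (intro smooth_add smooth_cmult smooth_bounded_linear bounded_linear_nth_fst)

lemma d_dep_s: "d_dep K s = (\<lambda>z. 0)"
  and d_indep_s: "d_indep i s = (\<lambda>z. if i = 3 then d else if i = 2 then \<mu> else 0)"
proof -
  have sm: "smooth (\<lambda>z::point. fst z $ i)" for i
    by (rule smooth_bounded_linear[OF bounded_linear_nth_fst])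
  have "dir_deriv h s = (\<lambda>z. d * fst h $ 3 + \<mu> * fst h $ 2)" for h
    unfolding s_def
    by (simp add: dir_deriv_add dir_deriv_cmult smooth_cmult sm dir_deriv_bounded_linear[OF bounded_linear_nth_fst])
  then show "d_dep K s = (\<lambda>z. 0)"
    "d_indep i s = (\<lambda>z. if i = 3 then d else if i = 2 then \<mu> else 0)"
    by (auto simp: axis_def)
qed

lemma travelling_s: "travelling s" and D_s: "D s = (\<lambda>z. 1)"
  using d by (simp_all add: travelling_def smooth_s d_dep_s d_indep_s D_def)

lemma travelling_const: "travelling (\<lambda>z. k)" and D_const: "D (\<lambda>z. k) = (\<lambda>z. 0)"
  by (simp_all add: travelling_def D_def smooth_const)

lemma travelling_diff:
  assumes "travelling F" "travelling G"
  shows "travelling (\<lambda>z. F z - G z)" "D (\<lambda>z. F z - G z) = (\<lambda>z. D F z - D G z)"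
  using assms
  by (simp_all add: travelling_def D_def smooth_diff dir_deriv_diff algebra_simps diff_divide_distrib)

lemma travelling_mult:
  assumes "travelling F" "travelling G"
  shows "travelling (\<lambda>z. F z * G z)" "D (\<lambda>z. F z * G z) = (\<lambda>z. F z * D G z + D F z * G z)"
proof -
  note F = travelling_partials[OF assms(1)] and G = travelling_partials[OF assms(2)]
  show "travelling (\<lambda>z. F z * G z)"
    by (simp add: travelling_def smooth_mult dir_deriv_mult F G algebra_simps)
  show "D (\<lambda>z. F z * G z) = (\<lambda>z. F z * D G z + D F z * G z)"
    by (simp add: D_def[of "\<lambda>z. _ z * _ z"] dir_deriv_mult F G)
       (use d in \<open>simp add: fun_eq_iff field_simps\<close>)
qed

lemma travelling_add:
  assumes "travelling F" "travelling G"
  shows "travelling (\<lambda>z. F z + G z)" "D (\<lambda>z. F z + G z) = (\<lambda>z. D F z + D G z)"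
  using assms
  by (simp_all add: travelling_def D_def smooth_add dir_deriv_add algebra_simps add_divide_distrib)

lemmas travelling_rules = travelling_s D_s travelling_const D_const travelling_add travelling_diff travelling_mult

text \<open>Integration three times: after subtraction of an antiderivative in \<open>s\<close>, the
  rest has zero \<open>D\<close> and is constant by \<open>travelling_constant\<close>.\<close>

lemma travelling_polynomial:
  assumes F: "travelling F" and D3: "\<And>z. D (D (D F)) z = 0"
  obtains k6 k5 k4 where "F = (\<lambda>z. k6 * (s z)\<^sup>2 + k5 * s z + k4)" "D F = (\<lambda>z. 2 * k6 * s z + k5)"
proof -
  define h where "h = D (D F) 0"
  define k where "k = D F 0"
  \<comment> \<open>Half of the constant second derivative, which is the coefficient of the square
    of \<open>s\<close>.\<close>
  define q where "q = h / 2"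
  have q: "h = q + q" by (simp add: q_def)
  have DF: "travelling (D F)" by (intro travelling_D F)
  have h: "D (D F) z = h" for z
    using travelling_constant[OF travelling_D[OF DF] D3] unfolding h_def .
  have [simp]: "s 0 = 0" by (simp add: s_def)
  have g: "D F z = h * s z + k" for z
    using travelling_constant[of "\<lambda>z. D F z - h * s z" z] by (simp add: travelling_rules DF h k_def)
  have t: "travelling (\<lambda>z. F z - q * (s z * s z) - k * s z)"
    by (intro travelling_rules F)
  have "D (\<lambda>z. F z - q * (s z * s z) - k * s z) = (\<lambda>z. D F z - q * (s z + s z) - k)"
    by (simp add: travelling_rules F)
  then have D0: "D (\<lambda>z. F z - q * (s z * s z) - k * s z) z = 0" for z
    by (simp add: g q algebra_simps)
  have "F z = q * (s z)\<^sup>2 + k * s z + F 0" for z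
    using travelling_constant[OF t D0, of z] by (simp add: algebra_simps power2_eq_square)
  then have "F = (\<lambda>z. q * (s z)\<^sup>2 + k * s z + F 0)" by (rule ext)
  moreover have "D F = (\<lambda>z. 2 * q * s z + k)"
    by (rule ext) (simp add: g q algebra_simps)
  ultimately show thesis by (rule that)
qed

subsection \<open>The six-parameter family\<close>

text \<open>The rotation angle as a quadratic polynomial in the phase. Parameters carry the number
  of the basis field they belong to, and the family is closed under \<open>D\<close>.\<close>

definition \<Theta> :: "real \<Rightarrow> real \<Rightarrow> real \<Rightarrow> point \<Rightarrow> real" where
  "\<Theta> k6 k5 k4 z = k6 * (s z * s z) + k5 * s z + k4"

lemma travelling_\<Theta>: "travelling (\<Theta> k6 k5 k4)"
  unfolding \<Theta>_def by (intro travelling_rules)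

lemma D_\<Theta>: "D (\<Theta> k6 k5 k4) = \<Theta> 0 (2 * k6) k5"
  unfolding \<Theta>_def by (simp add: travelling_rules algebra_simps)

text \<open>The general combination of the six fields. Here \<open>k1\<close>, \<open>k2\<close>,
  \<open>k3\<close> follow the coordinates x, y, t, so the time translation is governed by
  \<open>k3\<close>.\<close>

definition Phi :: "real \<Rightarrow> real \<Rightarrow> real \<Rightarrow> real \<Rightarrow> real \<Rightarrow> real \<Rightarrow> point \<Rightarrow> point" where
  "Phi k1 k2 k3 k4 k5 k6 z = (vector [k1, k2, k3],
     vector [- (snd z $ 2 * \<Theta> k6 k5 k4 z), snd z $ 1 * \<Theta> k6 k5 k4 z, \<Theta> 0 (2 * k6) k5 z / (w * \<mu>)])"

lemma Phi_nth:
  "fst (Phi k1 k2 k3 k4 k5 k6 z) $ l = (vector [k1, k2, k3] :: real^3) $ l"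
  "snd (Phi k1 k2 k3 k4 k5 k6 z) $ 1 = - (snd z $ 2 * \<Theta> k6 k5 k4 z)"
  "snd (Phi k1 k2 k3 k4 k5 k6 z) $ 2 = snd z $ 1 * \<Theta> k6 k5 k4 z"
  "snd (Phi k1 k2 k3 k4 k5 k6 z) $ 3 = \<Theta> 0 (2 * k6) k5 z / (w * \<mu>)"
  by (simp_all add: Phi_def)

lemma smooth_\<Theta>: "smooth (\<Theta> k6 k5 k4)"
  by (rule travelling_partials(1)[OF travelling_\<Theta>])

lemma smooth_Phi: "smooth (Phi k1 k2 k3 k4 k5 k6)"
proof (rule smooth_if_components)
  show "smooth (\<lambda>z. snd (Phi k1 k2 k3 k4 k5 k6 z) $ J)" for J
    using exhaust_3[of J]
    by (auto simp: Phi_nth intro!: smooth_minus smooth_mult smooth_divide smooth_coord smooth_\<Theta>)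
qed (simp add: Phi_nth smooth_const)

lemma d_\<Theta>:
  "d_dep K (\<Theta> k6 k5 k4) = (\<lambda>z. 0)"
  "d_indep i (\<Theta> k6 k5 k4) = (\<lambda>z. (if i = 3 then d else if i = 2 then \<mu> else 0) * \<Theta> 0 (2 * k6) k5 z)"
  using travelling_partials[OF travelling_\<Theta>] exhaust_3[of i] by (auto simp: D_\<Theta>)

lemma \<Theta>_const: "\<Theta> 0 0 k = (\<lambda>z. k)"
  by (simp add: \<Theta>_def fun_eq_iff)

text \<open>The field rotates psi by an angle depending on \<open>s\<close>. The second-order symbol
  does not see the gradient of the angle, the first-order part produces its derivative divided by
  \<mu>, and the phi-component compensates exactly this through the term w psi phi.\<close>

lemma Phi_symmetry: "Phi k1 k2 k3 k4 k5 k6 \<in> lie_symmetry_algebra pde"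
proof -
  let ?X = "Phi k1 k2 k3 k4 k5 k6"
  define F where "F = \<Theta> k6 k5 k4"
  define G where "G = \<Theta> 0 (2 * k6) k5"
  define h where "h = 2 * k6"
  have sm: "smooth F" "smooth G" unfolding F_def G_def by (rule smooth_\<Theta>)+
  have dF: "d_dep K F = (\<lambda>z. 0)" "d_indep i F = (\<lambda>z. (if i = 3 then d else if i = 2 then \<mu> else 0) * G z)"
    and dG: "d_dep K G = (\<lambda>z. 0)" "d_indep i G = (\<lambda>z. (if i = 3 then d else if i = 2 then \<mu> else 0) * h)" for K i
    unfolding F_def G_def h_def d_\<Theta> by (simp_all add: \<Theta>_const)
  have comp: "(\<lambda>z. snd (?X z) $ 1) = (\<lambda>z. - (snd z $ 2 * F z))" "(\<lambda>z. snd (?X z) $ 2) = (\<lambda>z. snd z $ 1 * F z)"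
    "(\<lambda>z. snd (?X z) $ 3) = (\<lambda>z. G z / (w * \<mu>))" "(\<lambda>z. fst (?X z) $ l) = (\<lambda>z. (vector [k1, k2, k3] :: real^3) $ l)" for l
    by (simp_all add: Phi_nth F_def G_def)
  note rules = dir_deriv_minus dir_deriv_mult dir_deriv_divide dir_deriv_cmult smooth_minus smooth_mult smooth_divide
    smooth_cmult smooth_coord sm smooth_const d_dep_coord d_indep_coord dF dG
  have T0: "total_D0 i (\<lambda>z::point. c) j = 0" for i and c :: real and j
    by (simp add: total_D0_expand smooth_const)
  have S0: "second_total i k (\<lambda>z::point. c) j = 0" for i k and c :: real and j
    by (cases j) (simp add: second_total_expand smooth_const)
  have d1: "d_dep K (\<lambda>z. - (snd z $ 2 * F z)) = (\<lambda>z. if K = 2 then - F z else 0)"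
    "d_indep i (\<lambda>z. - (snd z $ 2 * F z)) = (\<lambda>z. - (if i = 3 then d else if i = 2 then \<mu> else 0) * (snd z $ 2 * G z))"
    and d2: "d_dep K (\<lambda>z. snd z $ 1 * F z) = (\<lambda>z. if K = 1 then F z else 0)"
    "d_indep i (\<lambda>z. snd z $ 1 * F z) = (\<lambda>z. (if i = 3 then d else if i = 2 then \<mu> else 0) * (snd z $ 1 * G z))"
    and d3: "d_dep K (\<lambda>z. G z / (w * \<mu>)) = (\<lambda>z. 0)"
    "d_indep i (\<lambda>z. G z / (w * \<mu>)) = (\<lambda>z. (if i = 3 then d else if i = 2 then \<mu> else 0) * h / (w * \<mu>))" for K i
    by (auto simp: rules fun_eq_iff)
  have c1: "prolong_coeff1 ?X (z, p) $ 1 $ i = - (if i = 3 then d else if i = 2 then \<mu> else 0) * (snd z $ 2 * G z) - p $ 2 $ i * F z"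
    and c2: "prolong_coeff1 ?X (z, p) $ 2 $ i = (if i = 3 then d else if i = 2 then \<mu> else 0) * (snd z $ 1 * G z) + p $ 1 $ i * F z" for z p i
    unfolding prolong_coeff1_def vec_lambda_beta comp T0
    by (simp_all add: total_D0_expand rules sum_3)
  have sX: "smooth (\<lambda>z. fst (?X z) $ l)" "smooth (\<lambda>z. snd (?X z) $ J)" for l J
    by (rule smooth_components[OF smooth_Phi])+
  \<comment> \<open>The gradient of \<open>s\<close>.\<close>
  define \<delta> :: "3 \<Rightarrow> real" where "\<delta> i = (if i = 3 then d else if i = 2 then \<mu> else 0)" for i
  note d123 = d1 d2 d3
  have r1: "prolong_coeff2 ?X ((z, p), r) $ 1 $ i $ k = - (\<delta> i * \<delta> k * (snd z $ 2 * h)) - \<delta> i * G z * p $ 2 $ k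
      - \<delta> k * G z * p $ 2 $ i - r $ 2 $ i $ k * F z"
    and r2: "prolong_coeff2 ?X ((z, p), r) $ 2 $ i $ k = \<delta> i * \<delta> k * (snd z $ 1 * h) + \<delta> i * G z * p $ 1 $ k
      + \<delta> k * G z * p $ 1 $ i + r $ 1 $ i $ k * F z"
    and r3: "prolong_coeff2 ?X ((z, p), r) $ 3 $ i $ k = 0" for z p r i k
    unfolding prolong_coeff2_second_total[of ?X, OF sX] comp T0 S0
    by (simp_all add: second_total_expand d123[folded \<delta>_def] dF[folded \<delta>_def] dG[folded \<delta>_def] rules(1-12) d_indep_coord d_dep_coord sum_3 algebra_simps)
  have \<delta>: "\<delta> 1 = 0" "\<delta> 2 = \<mu>" "\<delta> 3 = d" by (simp_all add: \<delta>_def)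
  \<comment> \<open>The symmetric form of the second-order symbol in (y, t), applied to the gradient
    of \<open>s\<close> once (\<open>z1\<close>, \<open>z2\<close>) and twice
    (\<open>z3\<close>).\<close>
  have z1: "2 * a2 * \<mu> + a4 * d = 0" and z2: "2 * a3 * d + a4 * \<mu> = 0"
    and z3: "a2 * \<mu> * \<mu> + a3 * d * d + a4 * d * \<mu> = 0"
    by (simp_all add: a234)
  \<comment> \<open>Writes \<open>1 / \<mu>\<close> as \<open>a1 * d + a5 * \<mu>\<close>, so that
    the phi-component visibly cancels the first-order terms.\<close>
  have wG: "w * (x * (G z / (w * \<mu>)) + y) = x * ((a1 * d + a5 * \<mu>) * G z) + w * y" for x y z
    using w by (simp add: transversal distrib_left)
  show ?thesis
    unfolding symmetry_iff Let_def
  proof (intro conjI allI impI smooth_Phi)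
    fix z :: point and p :: "real^3^3" and r :: "real^3^3^3"
    let ?u = "snd z $ 1" and ?v = "snd z $ 2" and ?f = "snd z $ 3"
    assume E1: "a * r $ 1 $ 1 $ 1 + a2 * r $ 1 $ 2 $ 2 + a3 * r $ 1 $ 3 $ 3 + a4 * r $ 1 $ 3 $ 2
         = a1 * p $ 2 $ 3 + a5 * p $ 2 $ 2 + ((b - w * m) * (?u * ?u + ?v * ?v) * ?u - w * ?u * ?f)"
      and E2: "a * r $ 2 $ 1 $ 1 + a2 * r $ 2 $ 2 $ 2 + a3 * r $ 2 $ 3 $ 3 + a4 * r $ 2 $ 3 $ 2
         = - a1 * p $ 1 $ 3 - a5 * p $ 1 $ 2 + ((b - w * m) * (?u * ?u + ?v * ?v) * ?v - w * ?v * ?f)"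
    let ?p = "prolong_coeff1 ?X (z, p)" and ?r = "prolong_coeff2 ?X ((z, p), r)"
    show "a * ?r $ 1 $ 1 $ 1 + a2 * ?r $ 1 $ 2 $ 2 + a3 * ?r $ 1 $ 3 $ 3 + a4 * ?r $ 1 $ 3 $ 2
         = a1 * ?p $ 2 $ 3 + a5 * ?p $ 2 $ 2
         + ((b - w * m) * ((3 * ?u * ?u + ?v * ?v) * snd (?X z) $ 1 + 2 * ?u * ?v * snd (?X z) $ 2)
            - w * (?u * snd (?X z) $ 3 + snd (?X z) $ 1 * ?f))" (is "?L = ?R")
    proof -
      have "?L = - ?v * h * (a2 * \<mu> * \<mu> + a3 * d * d + a4 * d * \<mu>) - G z * p $ 2 $ 2 * (2 * a2 * \<mu> + a4 * d)
         - G z * p $ 2 $ 3 * (2 * a3 * d + a4 * \<mu>)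
         - F z * (a * r $ 2 $ 1 $ 1 + a2 * r $ 2 $ 2 $ 2 + a3 * r $ 2 $ 3 $ 3 + a4 * r $ 2 $ 3 $ 2)"
        unfolding r1 \<delta> by (simp add: algebra_simps)
      also have "\<dots> = ?R"
        unfolding z1 z2 z3 E2 c2 fun_cong[OF comp(1)] fun_cong[OF comp(2)] fun_cong[OF comp(3)] wG
        by (simp add: algebra_simps)
      finally show ?thesis .
    qed
    show "a * ?r $ 2 $ 1 $ 1 + a2 * ?r $ 2 $ 2 $ 2 + a3 * ?r $ 2 $ 3 $ 3 + a4 * ?r $ 2 $ 3 $ 2
         = - a1 * ?p $ 1 $ 3 - a5 * ?p $ 1 $ 2
         + ((b - w * m) * ((?u * ?u + 3 * ?v * ?v) * snd (?X z) $ 2 + 2 * ?u * ?v * snd (?X z) $ 1)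
            - w * (?v * snd (?X z) $ 3 + snd (?X z) $ 2 * ?f))" (is "?L = ?R")
    proof -
      have "?L = ?u * h * (a2 * \<mu> * \<mu> + a3 * d * d + a4 * d * \<mu>) + G z * p $ 1 $ 2 * (2 * a2 * \<mu> + a4 * d)
         + G z * p $ 1 $ 3 * (2 * a3 * d + a4 * \<mu>)
         + F z * (a * r $ 1 $ 1 $ 1 + a2 * r $ 1 $ 2 $ 2 + a3 * r $ 1 $ 3 $ 3 + a4 * r $ 1 $ 3 $ 2)"
        unfolding r2 \<delta> by (simp add: algebra_simps)
      also have "\<dots> = ?R"
        unfolding z1 z2 z3 E1 c1 fun_cong[OF comp(1)] fun_cong[OF comp(2)] fun_cong[OF comp(3)] wG
        by (simp add: algebra_simps)
      finally show ?thesis .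
    qed
    \<comment> \<open>Both sides vanish: the phi-component is affine in \<open>s\<close>, and a
      rotation preserves the squared modulus of psi even when its angle varies.\<close>
    show "?r $ 3 $ 1 $ 1 + \<kappa> * (?r $ 3 $ 2 $ 2 - ?r $ 3 $ 3 $ 3)
         = 2 * (2 * p $ 1 $ 2 * ?p $ 1 $ 2 + 2 * p $ 2 $ 2 * ?p $ 2 $ 2
             + ?u * ?r $ 1 $ 2 $ 2 + snd (?X z) $ 1 * r $ 1 $ 2 $ 2 + ?v * ?r $ 2 $ 2 $ 2 + snd (?X z) $ 2 * r $ 2 $ 2 $ 2)"
      unfolding r1 r2 r3 c1 c2 \<delta> fun_cong[OF comp(1)] fun_cong[OF comp(2)]
      by (simp add: algebra_simps)
  qed
qed

text \<open>Translations commute, and so do the rotations with their shifts of phi. What remains is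
  a translation differentiating the angle, at the rate \<open>\<mu> * k2 + d * k3\<close> at which
  it moves \<open>s\<close>.\<close>

lemma lie_bracket_Phi:
  "lie_bracket (Phi k1 k2 k3 k4 k5 k6) (Phi l1 l2 l3 l4 l5 l6) =
   Phi 0 0 0 ((\<mu> * k2 + d * k3) * l5 - (\<mu> * l2 + d * l3) * k5)
     (2 * ((\<mu> * k2 + d * k3) * l6 - (\<mu> * l2 + d * l3) * k6)) 0"
proof
  fix z
  have fst: "fst (dir_deriv h (Phi k1 k2 k3 k4 k5 k6) z) $ l = 0" for h k1 k2 k3 k4 k5 k6 l
    using dir_deriv_bounded_linear_comp[OF bounded_linear_nth_fst[of l] smooth_Phi[of k1 k2 k3 k4 k5 k6], of h z]
    by (simp add: Phi_nth)
  have T: "dir_deriv h (\<Theta> k6 k5 k4) = (\<lambda>z. (\<mu> * fst h $ 2 + d * fst h $ 3) * \<Theta> 0 (2 * k6) k5 z)" for h k6 k5 k4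
    by (rule ext, subst dir_deriv_eq_sum[OF smooth_\<Theta>]) (simp add: d_\<Theta> sum_3 algebra_simps)
  have C: "dir_deriv h (\<lambda>z. snd z $ K) = (\<lambda>z. snd h $ K)" for h K
    by (rule dir_deriv_bounded_linear[OF bounded_linear_nth_snd])
  have snd: "snd (dir_deriv h (Phi k1 k2 k3 k4 k5 k6) z) $ J = dir_deriv h (\<lambda>z. snd (Phi k1 k2 k3 k4 k5 k6 z) $ J) z"
    for h k1 k2 k3 k4 k5 k6 J
    using dir_deriv_bounded_linear_comp[OF bounded_linear_nth_snd smooth_Phi] by metis
  have bracket: "lie_bracket X Y z = dir_deriv (X z) Y z - dir_deriv (Y z) X z" for X Y :: "point \<Rightarrow> point"
    by (simp add: lie_bracket_def dir_deriv_def)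
  show "lie_bracket (Phi k1 k2 k3 k4 k5 k6) (Phi l1 l2 l3 l4 l5 l6) z =
   Phi 0 0 0 ((\<mu> * k2 + d * k3) * l5 - (\<mu> * l2 + d * l3) * k5)
     (2 * ((\<mu> * k2 + d * k3) * l6 - (\<mu> * l2 + d * l3) * k6)) 0 z"
    unfolding bracket prod_eq_iff vec_eq_iff forall_3
    by (simp add: fst snd Phi_nth dir_deriv_minus dir_deriv_mult dir_deriv_divide smooth_mult smooth_coord
          smooth_\<Theta> T C)
       (simp add: \<Theta>_def algebra_simps diff_divide_distrib add_divide_distrib)
qed

lemma Phi_add: "Phi k1 k2 k3 k4 k5 k6 + Phi l1 l2 l3 l4 l5 l6 = Phi (k1 + l1) (k2 + l2) (k3 + l3) (k4 + l4) (k5 + l5) (k6 + l6)"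
  and Phi_scaleR: "r *\<^sub>R Phi k1 k2 k3 k4 k5 k6 = Phi (r * k1) (r * k2) (r * k3) (r * k4) (r * k5) (r * k6)"
  by (simp_all add: fun_eq_iff prod_eq_iff vec_eq_iff forall_3 Phi_nth scaleR_fun_def \<Theta>_def)
    (simp_all add: algebra_simps add_divide_distrib)

lemma Phi_0: "Phi 0 0 0 0 0 0 = 0"
  by (simp add: fun_eq_iff prod_eq_iff vec_eq_iff forall_3 Phi_nth \<Theta>_def)

lemma Phi_eq_0D:
  assumes "Phi k1 k2 k3 k4 k5 k6 = 0"
  shows "k1 = 0 \<and> k2 = 0 \<and> k3 = 0 \<and> k4 = 0 \<and> k5 = 0 \<and> k6 = 0"
proof -
  \<comment> \<open>A point with u = 1 and phase exactly \<open>x\<close>, so the v-component is the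
    polynomial itself; its values at 0, 1 and -1 determine the coefficients.\<close>
  have "\<Theta> k6 k5 k4 (axis 3 (x / d), axis 1 1) = 0" for x
    using Phi_nth(3)[of k1 k2 k3 k4 k5 k6 "(axis 3 (x / d), axis 1 1)"] assms by simp
  then have "k6 * (x * x) + k5 * x + k4 = 0" for x
    using d by (simp add: \<Theta>_def s_def axis_def)
  from this[of 0] this[of 1] this[of "- 1"] have "k4 = 0" "k5 = 0" "k6 = 0" by simp_all
  moreover have "(vector [k1, k2, k3] :: real^3) $ l = 0" for l
    using Phi_nth(1)[of k1 k2 k3 k4 k5 k6 0 l] assms by simp
  from this[of 1] this[of 2] this[of 3] have "k1 = 0" "k2 = 0" "k3 = 0" by simp_all
  ultimately show ?thesis by simp
qed

end

section \<open>Determining equations\<close>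

text \<open>A unit entry, together with multiples of the \<open>xx\<close>-entries chosen to keep the jet in the kernel of
  the linearised equations.\<close>

definition test_jet :: "3 \<Rightarrow> 3 \<Rightarrow> 3 \<Rightarrow> real \<Rightarrow> real \<Rightarrow> real^3^3^3" where
  "test_jet J i k \<alpha> \<beta> = (\<chi> J' i' k'.
     (if J' = J \<and> (i' = i \<and> k' = k \<or> i' = k \<and> k' = i) then 1 else 0)
     + (if J' = J \<and> i' = 1 \<and> k' = 1 then \<alpha> else 0) + (if J' = 3 \<and> i' = 1 \<and> k' = 1 then \<beta> else 0))"

lemma test_jet_sym: "test_jet J i k \<alpha> \<beta> $ J' $ i' $ k' = test_jet J i k \<alpha> \<beta> $ J' $ k' $ i'"
  by (simp add: test_jet_def conj_commute disj_commute)

text \<open>A 1-jet with a single entry. Comparing small values of \<open>c\<close> separates the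
  degrees of a condition that is polynomial in that entry.\<close>

definition slope :: "3 \<Rightarrow> 3 \<Rightarrow> real \<Rightarrow> real^3^3" where
  "slope K l c = (\<chi> J i. if J = K \<and> i = l then c else 0)"

lemma slope_nth: "slope K l c $ J $ i = (if J = K \<and> i = l then c else 0)"
  by (simp add: slope_def)

lemma total_D0_slope:
  assumes "smooth F"
  shows "total_D0 i F (z, slope K l c) = d_indep i F z + (if i = l then c * d_dep K F z else 0)"
  using exhaust_3[of K] by (auto simp: total_D0_expand assms slope_nth sum_3)

lemma second_total_slope:
  assumes "smooth F"
  shows "second_total i k F (z, slope K l c) = d_indep k (d_indep i F) z
    + (if k = l then c * d_indep i (d_dep K F) z else 0) + (if i = l then c * d_indep k (d_dep K F) z else 0)
    + (if i = l \<and> k = l then c * c * d_dep K (d_dep K F) z else 0)"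
  using exhaust_3[of K] by (auto simp: second_total_expand assms slope_nth sum_3)

lemma second_total_0: "smooth F \<Longrightarrow> second_total i k F (z, 0) = d_indep k (d_indep i F) z"
  by (simp add: second_total_expand)

lemma total_D0_0: "smooth F \<Longrightarrow> total_D0 i F (z, 0) = d_indep i F z"
  by (simp add: total_D0_expand)

section \<open>The symmetry condition over a fixed 1-jet\<close>

locale symmetry_field = dispersive_system +
  fixes X :: "point \<Rightarrow> point"
  assumes X: "X \<in> lie_symmetry_algebra pde"
begin

definition \<xi> :: "3 \<Rightarrow> point \<Rightarrow> real" where "\<xi> l = (\<lambda>z. fst (X z) $ l)"
definition \<eta> :: "3 \<Rightarrow> point \<Rightarrow> real" where "\<eta> J = (\<lambda>z. snd (X z) $ J)"

lemma smooth_\<xi>: "smooth (\<xi> l)" and smooth_\<eta>: "smooth (\<eta> J)"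
  using smooth_components X unfolding \<xi>_def \<eta>_def symmetry_iff by blast+

lemma coeff1: "prolong_coeff1 X (z, p) $ J $ i =
    total_D0 i (\<eta> J) (z, p) - (\<Sum>l\<in>UNIV. total_D0 i (\<xi> l) (z, p) * p $ J $ l)"
  by (simp add: prolong_coeff1_def \<xi>_def \<eta>_def)

lemmas coeff2 = prolong_coeff2_second_total[of X, folded \<xi>_def \<eta>_def, OF smooth_\<xi> smooth_\<eta>]

definition coeff2_lin :: "point \<Rightarrow> real^3^3 \<Rightarrow> real^3^3^3 \<Rightarrow> 3 \<Rightarrow> 3 \<Rightarrow> 3 \<Rightarrow> real" where
  "coeff2_lin z p r J i k =
     (\<Sum>K\<in>UNIV. r $ K $ i $ k * (d_dep K (\<eta> J) z - (\<Sum>l\<in>UNIV. d_dep K (\<xi> l) z * p $ J $ l)))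
     - (\<Sum>l\<in>UNIV. total_D0 i (\<xi> l) (z, p) * r $ J $ l $ k + total_D0 k (\<xi> l) (z, p) * r $ J $ i $ l)"

lemma coeff2_add:
  "prolong_coeff2 X ((z, p), r + r') $ J $ i $ k
   = prolong_coeff2 X ((z, p), r) $ J $ i $ k + coeff2_lin z p r' J i k"
  unfolding coeff2 coeff2_lin_def by (simp add: algebra_simps sum.distrib sum_subtractf)

text \<open>Since \<open>a \<noteq> 0\<close>, every 1-jet extends to a solution by prescribing the \<open>xx\<close>-derivatives.\<close>

definition base_jet :: "point \<Rightarrow> real^3^3 \<Rightarrow> real^3^3^3" where
  "base_jet z p = (let u = snd z $ 1; v = snd z $ 2; \<phi> = snd z $ 3 in \<chi> J i k.
     if i = 1 \<and> k = 1 then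
       (if J = 1 then (a1 * p $ 2 $ 3 + a5 * p $ 2 $ 2 + ((b - w * m) * (u * u + v * v) * u - w * u * \<phi>)) / a
        else if J = 2 then (- a1 * p $ 1 $ 3 - a5 * p $ 1 $ 2 + ((b - w * m) * (u * u + v * v) * v - w * v * \<phi>)) / a
        else 2 * (p $ 1 $ 2 * p $ 1 $ 2 + p $ 2 $ 2 * p $ 2 $ 2))
     else 0)"

text \<open>The assumptions put \<open>r\<close> into the kernel of the second-order parts of the
  equations at \<open>z\<close>, so \<open>base_jet z p + r\<close> is again a solution jet.\<close>

lemma symmetry_condition:
  fixes z p
  assumes "\<And>J i k. r $ J $ i $ k = r $ J $ k $ i"
    "a * r $ 1 $ 1 $ 1 + a2 * r $ 1 $ 2 $ 2 + a3 * r $ 1 $ 3 $ 3 + a4 * r $ 1 $ 3 $ 2 = 0"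
    "a * r $ 2 $ 1 $ 1 + a2 * r $ 2 $ 2 $ 2 + a3 * r $ 2 $ 3 $ 3 + a4 * r $ 2 $ 3 $ 2 = 0"
    "r $ 3 $ 1 $ 1 + \<kappa> * (r $ 3 $ 2 $ 2 - r $ 3 $ 3 $ 3)
      = 2 * (snd z $ 1 * r $ 1 $ 2 $ 2 + snd z $ 2 * r $ 2 $ 2 $ 2)"
  defines "r' \<equiv> prolong_coeff2 X ((z, p), base_jet z p + r)"
    and "p' \<equiv> prolong_coeff1 X (z, p)"
    and "u \<equiv> snd z $ 1" and "v \<equiv> snd z $ 2" and "\<phi> \<equiv> snd z $ 3"
  shows
    "a * r' $ 1 $ 1 $ 1 + a2 * r' $ 1 $ 2 $ 2 + a3 * r' $ 1 $ 3 $ 3 + a4 * r' $ 1 $ 3 $ 2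
       = a1 * p' $ 2 $ 3 + a5 * p' $ 2 $ 2
       + ((b - w * m) * ((3 * u * u + v * v) * \<eta> 1 z + 2 * u * v * \<eta> 2 z) - w * (u * \<eta> 3 z + \<eta> 1 z * \<phi>))"
    "a * r' $ 2 $ 1 $ 1 + a2 * r' $ 2 $ 2 $ 2 + a3 * r' $ 2 $ 3 $ 3 + a4 * r' $ 2 $ 3 $ 2
       = - a1 * p' $ 1 $ 3 - a5 * p' $ 1 $ 2
       + ((b - w * m) * ((u * u + 3 * v * v) * \<eta> 2 z + 2 * u * v * \<eta> 1 z) - w * (v * \<eta> 3 z + \<eta> 2 z * \<phi>))"
    "r' $ 3 $ 1 $ 1 + \<kappa> * (r' $ 3 $ 2 $ 2 - r' $ 3 $ 3 $ 3)
       = 2 * (2 * p $ 1 $ 2 * p' $ 1 $ 2 + 2 * p $ 2 $ 2 * p' $ 2 $ 2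
             + u * r' $ 1 $ 2 $ 2 + \<eta> 1 z * r $ 1 $ 2 $ 2 + v * r' $ 2 $ 2 $ 2 + \<eta> 2 z * r $ 2 $ 2 $ 2)"
proof -
  let ?R = "base_jet z p + r"
  have sym: "\<forall>J i k. ?R $ J $ i $ k = ?R $ J $ k $ i"
    using assms(1) by (simp add: base_jet_def Let_def)
  note inst = X[unfolded symmetry_iff Let_def, THEN conjunct2, rule_format, OF sym[rule_format], of p z]
  have r22: "?R $ 1 $ 2 $ 2 = r $ 1 $ 2 $ 2" "?R $ 2 $ 2 $ 2 = r $ 2 $ 2 $ 2"
    by (simp_all add: base_jet_def Let_def)
  note inst = inst[folded r'_def p'_def u_def v_def \<phi>_def, unfolded r22, folded fun_cong[OF \<eta>_def]]
  have *: "a * (x / a + y) = x + a * y" for x y using a by (simp add: distrib_left)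
  have 1: "a * ?R $ 1 $ 1 $ 1 + a2 * ?R $ 1 $ 2 $ 2 + a3 * ?R $ 1 $ 3 $ 3 + a4 * ?R $ 1 $ 3 $ 2
     = a1 * p $ 2 $ 3 + a5 * p $ 2 $ 2 + ((b - w * m) * (u * u + v * v) * u - w * u * \<phi>)"
    using assms(2) by (simp add: base_jet_def Let_def * u_def v_def \<phi>_def)
  have 2: "a * ?R $ 2 $ 1 $ 1 + a2 * ?R $ 2 $ 2 $ 2 + a3 * ?R $ 2 $ 3 $ 3 + a4 * ?R $ 2 $ 3 $ 2
     = - a1 * p $ 1 $ 3 - a5 * p $ 1 $ 2 + ((b - w * m) * (u * u + v * v) * v - w * v * \<phi>)"
    using assms(3) by (simp add: base_jet_def Let_def * u_def v_def \<phi>_def)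
  have 3: "?R $ 3 $ 1 $ 1 + \<kappa> * (?R $ 3 $ 2 $ 2 - ?R $ 3 $ 3 $ 3)
     = 2 * (p $ 1 $ 2 * p $ 1 $ 2 + p $ 2 $ 2 * p $ 2 $ 2 + u * ?R $ 1 $ 2 $ 2 + v * ?R $ 2 $ 2 $ 2)"
    using assms(4) by (simp add: base_jet_def Let_def u_def v_def)
  show "a * r' $ 1 $ 1 $ 1 + a2 * r' $ 1 $ 2 $ 2 + a3 * r' $ 1 $ 3 $ 3 + a4 * r' $ 1 $ 3 $ 2
       = a1 * p' $ 2 $ 3 + a5 * p' $ 2 $ 2
       + ((b - w * m) * ((3 * u * u + v * v) * \<eta> 1 z + 2 * u * v * \<eta> 2 z) - w * (u * \<eta> 3 z + \<eta> 1 z * \<phi>))"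
    "a * r' $ 2 $ 1 $ 1 + a2 * r' $ 2 $ 2 $ 2 + a3 * r' $ 2 $ 3 $ 3 + a4 * r' $ 2 $ 3 $ 2
       = - a1 * p' $ 1 $ 3 - a5 * p' $ 1 $ 2
       + ((b - w * m) * ((u * u + 3 * v * v) * \<eta> 2 z + 2 * u * v * \<eta> 1 z) - w * (v * \<eta> 3 z + \<eta> 2 z * \<phi>))"
    "r' $ 3 $ 1 $ 1 + \<kappa> * (r' $ 3 $ 2 $ 2 - r' $ 3 $ 3 $ 3)
       = 2 * (2 * p $ 1 $ 2 * p' $ 1 $ 2 + 2 * p $ 2 $ 2 * p' $ 2 $ 2
             + u * r' $ 1 $ 2 $ 2 + \<eta> 1 z * r $ 1 $ 2 $ 2 + v * r' $ 2 $ 2 $ 2 + \<eta> 2 z * r $ 2 $ 2 $ 2)"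
    using inst[OF 1[unfolded r22] 2[unfolded r22] 3[unfolded r22]] by blast+
qed

lemma base_condition:
  fixes z p
  defines "r' \<equiv> prolong_coeff2 X ((z, p), base_jet z p)"
    and "p' \<equiv> prolong_coeff1 X (z, p)"
    and "u \<equiv> snd z $ 1" and "v \<equiv> snd z $ 2" and "\<phi> \<equiv> snd z $ 3"
  shows
    "a * r' $ 1 $ 1 $ 1 + a2 * r' $ 1 $ 2 $ 2 + a3 * r' $ 1 $ 3 $ 3 + a4 * r' $ 1 $ 3 $ 2
       = a1 * p' $ 2 $ 3 + a5 * p' $ 2 $ 2
       + ((b - w * m) * ((3 * u * u + v * v) * \<eta> 1 z + 2 * u * v * \<eta> 2 z) - w * (u * \<eta> 3 z + \<eta> 1 z * \<phi>))"
    "a * r' $ 2 $ 1 $ 1 + a2 * r' $ 2 $ 2 $ 2 + a3 * r' $ 2 $ 3 $ 3 + a4 * r' $ 2 $ 3 $ 2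
       = - a1 * p' $ 1 $ 3 - a5 * p' $ 1 $ 2
       + ((b - w * m) * ((u * u + 3 * v * v) * \<eta> 2 z + 2 * u * v * \<eta> 1 z) - w * (v * \<eta> 3 z + \<eta> 2 z * \<phi>))"
    "r' $ 3 $ 1 $ 1 + \<kappa> * (r' $ 3 $ 2 $ 2 - r' $ 3 $ 3 $ 3)
       = 2 * (2 * p $ 1 $ 2 * p' $ 1 $ 2 + 2 * p $ 2 $ 2 * p' $ 2 $ 2
             + u * r' $ 1 $ 2 $ 2 + v * r' $ 2 $ 2 $ 2)"
  using symmetry_condition[of 0 z p] unfolding assms by simp_all

text \<open>The difference of the conditions at \<open>base_jet z p + r\<close> and at
  \<open>base_jet z p\<close>: everything free of \<open>r\<close> cancels.\<close>

lemma linear_condition: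
  fixes z p
  assumes "\<And>J i k. r $ J $ i $ k = r $ J $ k $ i"
    "a * r $ 1 $ 1 $ 1 + a2 * r $ 1 $ 2 $ 2 + a3 * r $ 1 $ 3 $ 3 + a4 * r $ 1 $ 3 $ 2 = 0"
    "a * r $ 2 $ 1 $ 1 + a2 * r $ 2 $ 2 $ 2 + a3 * r $ 2 $ 3 $ 3 + a4 * r $ 2 $ 3 $ 2 = 0"
    "r $ 3 $ 1 $ 1 + \<kappa> * (r $ 3 $ 2 $ 2 - r $ 3 $ 3 $ 3)
      = 2 * (snd z $ 1 * r $ 1 $ 2 $ 2 + snd z $ 2 * r $ 2 $ 2 $ 2)"
  defines "L \<equiv> coeff2_lin z p r"
  shows
    "a * L 1 1 1 + a2 * L 1 2 2 + a3 * L 1 3 3 + a4 * L 1 3 2 = 0"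
    "a * L 2 1 1 + a2 * L 2 2 2 + a3 * L 2 3 3 + a4 * L 2 3 2 = 0"
    "L 3 1 1 + \<kappa> * (L 3 2 2 - L 3 3 3)
       = 2 * (snd z $ 1 * L 1 2 2 + \<eta> 1 z * r $ 1 $ 2 $ 2 + snd z $ 2 * L 2 2 2 + \<eta> 2 z * r $ 2 $ 2 $ 2)"
  using symmetry_condition[OF assms(1-4), of p] base_condition[of z p]
  unfolding coeff2_add L_def by (simp_all add: distrib_left right_diff_distrib)

section \<open>Terms linear in the second derivatives\<close>

lemmas test_condition = linear_condition[OF test_jet_sym]

text \<open>The derivative phi_yt occurs in no equation and can be varied alone. The prolonged
  equations for psi meet it with the nonzero factor \<open>a4\<close>, for every first-order part
  \<open>p\<close>.\<close>

lemma d_dep_3_zero: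
  shows "d_dep 3 (\<eta> 1) z = 0" "d_dep 3 (\<eta> 2) z = 0" "d_dep 3 (\<xi> l) z = 0"
proof -
  have *: "d_dep 3 (\<eta> J) z = (\<Sum>l\<in>UNIV. d_dep 3 (\<xi> l) z * p $ J $ l)" if "J = 1 \<or> J = 2" for p J
    using that test_condition(1,2)[of 3 2 3 0 0 z p] a24(2)
    by (auto simp: coeff2_lin_def test_jet_def sum_3)
  show "d_dep 3 (\<eta> 1) z = 0" "d_dep 3 (\<eta> 2) z = 0"
    using *[of 1 0] *[of 2 0] by simp_all
  then show "d_dep 3 (\<xi> l) z = 0"
    using *[of 1 "\<chi> J. axis l 1"] exhaust_3[of l] by (auto simp: axis_def sum_3)
qed

lemma total_\<xi>: "total_D0 i (\<xi> l) (z, p) = d_indep i (\<xi> l) z + p $ 1 $ i * d_dep 1 (\<xi> l) z + p $ 2 $ i * d_dep 2 (\<xi> l) z"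
  by (simp add: total_D0_expand smooth_\<xi> sum_3 d_dep_3_zero)

text \<open>The derivatives u_xy and u_xt occur in no equation, so their coefficients vanish. These
  are the (x, y)- and (x, t)-entries of conformality for the symbol of the psi-equation.\<close>

lemma cross_conditions:
  fixes z p
  defines "S \<equiv> \<lambda>i l. total_D0 i (\<xi> l) (z, p)"
  shows "2 * a * S 1 2 + 2 * a2 * S 2 1 + a4 * S 3 1 = 0"
    and "2 * a * S 1 3 + 2 * a3 * S 3 1 + a4 * S 2 1 = 0"
  using test_condition(1)[of 1 1 2 0 0 z p] test_condition(1)[of 1 1 3 0 0 z p]
  by (auto simp: coeff2_lin_def test_jet_def sum_3 d_dep_3_zero S_def algebra_simps)

lemma d_dep_\<xi>: "d_dep K (\<xi> l) z = 0"
proof -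
  have *: "d_dep K (\<xi> l) z = 0" if "K = 1 \<or> K = 2" for K l
  proof -
    \<comment> \<open>The cross conditions hold at every \<open>p\<close> and are affine in it; unit
      increments in the x- and y-slopes isolate the derivatives in the dependent variables.\<close>
    define P where "P i = (\<chi> J k. if J = K \<and> k = i then 1 else (0::real))" for i :: 3
    have t: "total_D0 i (\<xi> l) (z, P k) = d_indep i (\<xi> l) z + (if i = k then d_dep K (\<xi> l) z else 0)" for i k l
      using that by (auto simp: total_\<xi> P_def)
    note * = cross_conditions[of z 0, unfolded total_\<xi>, simplified]
    note 1 = cross_conditions[of z "P 1", unfolded t distrib_left, simplified]
    note 2 = cross_conditions[of z "P 2", unfolded t distrib_left, simplified]
    have "2 * a * d_dep K (\<xi> 2) z = 0" "2 * a * d_dep K (\<xi> 3) z = 0" "2 * a2 * d_dep K (\<xi> 1) z = 0"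
      using * 1 2 by linarith+
    then show ?thesis
      using a a24(1) exhaust_3[of l] by auto
  qed
  show ?thesis
    using exhaust_3[of K] *[of K l] d_dep_3_zero(3)[of l z] by auto
qed

lemma d_dep_\<xi>': "d_dep K (\<xi> l) = (\<lambda>z. 0)"
  using d_dep_\<xi> by blast

lemma total_\<xi>': "total_D0 i (\<xi> l) (z, p) = d_indep i (\<xi> l) z"
  by (simp add: total_\<xi> d_dep_\<xi>)

text \<open>The free derivative u_xy reaches the equation for phi only through the source term u
  u_yy, which leaves a factor u. The other factor does not involve u, so
  \<open>coord_mult_zeroD\<close> removes it.\<close>

lemma jacobian_2_1: "d_indep 2 (\<xi> 1) z = 0"
proof (rule coord_mult_zeroD[of _ 1])
  show "smooth (d_indep 2 (\<xi> 1))"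
    by (intro smooth_dir_deriv smooth_\<xi>)
  show "d_dep 1 (d_indep 2 (\<xi> 1)) z = 0" for z
    using dir_deriv_commute[OF smooth_\<xi>, of "(0, axis 1 1)"] by (simp add: d_dep_\<xi>')
  show "snd z $ 1 * d_indep 2 (\<xi> 1) z = 0" for z
    using test_condition(3)[of 1 1 2 0 0 z 0]
    by (simp add: coeff2_lin_def test_jet_def sum_3 d_dep_3_zero total_\<xi>' d_dep_\<xi>)
qed

lemma jacobian_offdiag:
  shows "d_indep 1 (\<xi> 2) z = 0" "d_indep 1 (\<xi> 3) z = 0" "d_indep 3 (\<xi> 1) z = 0"
    and "d_indep 2 (\<xi> 3) z = 0" "d_indep 3 (\<xi> 2) z = 0"
    and jacobian_diag: "d_indep 2 (\<xi> 2) z = d_indep 1 (\<xi> 1) z" "d_indep 3 (\<xi> 3) z = d_indep 1 (\<xi> 1) z"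
proof -
  note simps = coeff2_lin_def test_jet_def sum_3 d_dep_3_zero total_\<xi>' d_dep_\<xi> jacobian_2_1
  show 1: "d_indep 1 (\<xi> 2) z = 0"
    using cross_conditions(1)[of z 0] test_condition(3)[of 3 1 2 0 0 z 0] 
    by (simp add: simps)
  show 2: "d_indep 3 (\<xi> 1) z = 0"
    using cross_conditions(1)[of z 0] 1 a24(2) by (simp add: simps)
  show 3: "d_indep 1 (\<xi> 3) z = 0"
    using cross_conditions(2)[of z 0] 2 a by (simp add: simps)
  show 4: "d_indep 2 (\<xi> 2) z = d_indep 1 (\<xi> 1) z"
    using test_condition(3)[of 3 2 2 "- \<kappa>" 0 z 0] kappa(1)
    by (simp add: simps algebra_simps)
  show "d_indep 3 (\<xi> 3) z = d_indep 1 (\<xi> 1) z"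
    using test_condition(3)[of 3 3 3 \<kappa> 0 z 0] kappa(1)
    by (simp add: simps algebra_simps)
  \<comment> \<open>Here u_yy = 1 is balanced by u_xx in the first equation and by phi_xx = 2u in
    the third. This excludes the boost, which the phi_yt test alone would allow.\<close>
  show 6: "d_indep 3 (\<xi> 2) z = 0"
    using test_condition(1)[of 1 2 2 "- a2 / a" "2 * snd z $ 1" z 0] 4 a a24(2)
    by (simp add: simps field_simps)
  show "d_indep 2 (\<xi> 3) z = 0"
    using test_condition(3)[of 3 2 3 0 0 z 0] 6 kappa(1)
    by (simp add: simps)
qed

text \<open>The pair u_yt = 1, u_xx = - a4 / a solves the linearised psi-equation without touching
  the source of the phi-equation, where only u_xx times the wanted derivative survives.\<close>

lemma d_dep_\<eta>3: "d_dep 1 (\<eta> 3) z = 0" "d_dep 2 (\<eta> 3) z = 0"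
  using test_condition(3)[of 1 2 3 "- a4 / a" 0 z 0] test_condition(3)[of 2 2 3 "- a4 / a" 0 z 0] a a24(2)
  by (simp_all add: coeff2_lin_def test_jet_def sum_3 d_dep_3_zero total_\<xi>' d_dep_\<xi>
      jacobian_2_1 jacobian_offdiag)

text \<open>A variation of u_yy or v_yy changes the source of the phi-equation and is balanced there
  by phi_xx. The differentiated source contributes the component of \<open>X\<close> itself, and the
  conformal factor cancels.\<close>

lemma \<eta>_identities:
  shows "\<eta> 1 z = snd z $ 1 * d_dep 3 (\<eta> 3) z - snd z $ 1 * d_dep 1 (\<eta> 1) z - snd z $ 2 * d_dep 1 (\<eta> 2) z"
    and "\<eta> 2 z = snd z $ 2 * d_dep 3 (\<eta> 3) z - snd z $ 1 * d_dep 2 (\<eta> 1) z - snd z $ 2 * d_dep 2 (\<eta> 2) z"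
  using test_condition(3)[of 1 2 2 "- a2 / a" "2 * snd z $ 1" z 0]
    test_condition(3)[of 2 2 2 "- a2 / a" "2 * snd z $ 2" z 0] a
  by (simp_all add: coeff2_lin_def test_jet_def sum_3 d_dep_3_zero total_\<xi>' d_dep_\<xi>
      jacobian_2_1 jacobian_offdiag jacobian_diag d_dep_\<eta>3 algebra_simps)

definition \<sigma> :: "point \<Rightarrow> real" where "\<sigma> = d_indep 1 (\<xi> 1)"

lemma d_indep_\<xi>: "d_indep i (\<xi> l) = (if i = l then \<sigma> else (\<lambda>z. 0))"
  using exhaust_3[of i] exhaust_3[of l]
  by (auto simp: fun_eq_iff \<sigma>_def jacobian_2_1 jacobian_offdiag jacobian_diag)

text \<open>The Jacobian is \<sigma> times the identity. Choosing \<open>l\<close> different from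
  \<open>i\<close>, the derivative of \<sigma> is a mixed second derivative of
  \<open>\<xi> l\<close> that also contains a vanishing off-diagonal entry.\<close>

lemma d_indep_\<sigma>: "d_indep i \<sigma> = (\<lambda>z. 0)"
proof -
  obtain l where l: "l \<noteq> i"
    using that[of 1] that[of 2] by (cases "i = 1") simp_all
  have "d_indep i \<sigma> = d_indep i (d_indep l (\<xi> l))"
    by (simp add: d_indep_\<xi>)
  also have "\<dots> = d_indep l (d_indep i (\<xi> l))"
    by (rule dir_deriv_commute[OF smooth_\<xi>])
  finally show ?thesis using l by (simp add: d_indep_\<xi>)
qed

lemma second_total_\<xi>: "second_total i k (\<xi> l) j = 0"
  by (cases j) (simp add: second_total_expand smooth_\<xi> d_dep_\<xi>' d_indep_\<xi> d_indep_\<sigma>)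

lemma coeff1': "prolong_coeff1 X (z, p) $ J $ i = total_D0 i (\<eta> J) (z, p) - \<sigma> z * p $ J $ i"
  using exhaust_3[of i] by (auto simp: coeff1 total_\<xi>' sum_3 d_indep_\<xi>)

lemma coeff2': "prolong_coeff2 X ((z, p), r) $ J $ i $ k =
   second_total i k (\<eta> J) (z, p) + (\<Sum>K\<in>UNIV. r $ K $ i $ k * d_dep K (\<eta> J) z) - 2 * \<sigma> z * r $ J $ i $ k"
  using exhaust_3[of i] exhaust_3[of k]
  by (auto simp: coeff2 total_\<xi>' sum_3 d_indep_\<xi> d_dep_\<xi> second_total_\<xi>)

section \<open>Terms of first order: rotation and scaling of psi\<close>

definition f1 :: "point \<Rightarrow> real" where
  "f1 z = (b - w * m) * (snd z $ 1 * snd z $ 1 + snd z $ 2 * snd z $ 2) * snd z $ 1 - w * snd z $ 1 * snd z $ 3"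
definition f2 :: "point \<Rightarrow> real" where
  "f2 z = (b - w * m) * (snd z $ 1 * snd z $ 1 + snd z $ 2 * snd z $ 2) * snd z $ 2 - w * snd z $ 2 * snd z $ 3"
text \<open>The derivatives along \<open>X\<close> of \<open>f1\<close> and \<open>f2\<close>, which
  are the real and imaginary parts of the derivative-free side of the psi-equation.\<close>

definition Xf1 :: "point \<Rightarrow> real" where
  "Xf1 z = (b - w * m) * ((3 * snd z $ 1 * snd z $ 1 + snd z $ 2 * snd z $ 2) * \<eta> 1 z
      + 2 * snd z $ 1 * snd z $ 2 * \<eta> 2 z) - w * (snd z $ 1 * \<eta> 3 z + \<eta> 1 z * snd z $ 3)"
definition Xf2 :: "point \<Rightarrow> real" where
  "Xf2 z = (b - w * m) * ((snd z $ 1 * snd z $ 1 + 3 * snd z $ 2 * snd z $ 2) * \<eta> 2 z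
      + 2 * snd z $ 1 * snd z $ 2 * \<eta> 1 z) - w * (snd z $ 2 * \<eta> 3 z + \<eta> 2 z * snd z $ 3)"

text \<open>At a base jet the xx-derivatives are \<open>F1 / a\<close> and \<open>F2 / a\<close>, so
  no second derivative is left and the conditions are polynomial in \<open>p\<close>.\<close>

lemma first_order_conditions:
  fixes z p
  defines "N J \<equiv> a * second_total 1 1 (\<eta> J) (z, p) + a2 * second_total 2 2 (\<eta> J) (z, p)
     + a3 * second_total 3 3 (\<eta> J) (z, p) + a4 * second_total 3 2 (\<eta> J) (z, p)"
    and "F1 \<equiv> a1 * p $ 2 $ 3 + a5 * p $ 2 $ 2 + f1 z" and "F2 \<equiv> - a1 * p $ 1 $ 3 - a5 * p $ 1 $ 2 + f2 z"
  shows "N 1 + d_dep 1 (\<eta> 1) z * F1 + d_dep 2 (\<eta> 1) z * F2 - 2 * \<sigma> z * F1 =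
      a1 * (total_D0 3 (\<eta> 2) (z, p) - \<sigma> z * p $ 2 $ 3) + a5 * (total_D0 2 (\<eta> 2) (z, p) - \<sigma> z * p $ 2 $ 2) + Xf1 z"
    and "N 2 + d_dep 1 (\<eta> 2) z * F1 + d_dep 2 (\<eta> 2) z * F2 - 2 * \<sigma> z * F2 =
      - a1 * (total_D0 3 (\<eta> 1) (z, p) - \<sigma> z * p $ 1 $ 3) - a5 * (total_D0 2 (\<eta> 1) (z, p) - \<sigma> z * p $ 1 $ 2) + Xf2 z"
proof -
  define g1 g2 where "g1 = F1 / a" and "g2 = F2 / a"
  have F: "F1 = a * g1" "F2 = a * g2"
    using a by (simp_all add: g1_def g2_def)
  have b: "base_jet z p $ 1 $ 1 $ 1 = g1" "base_jet z p $ 2 $ 1 $ 1 = g2"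
    "i \<noteq> 1 \<or> k \<noteq> 1 \<Longrightarrow> base_jet z p $ J $ i $ k = 0" for J i k
    by (auto simp: base_jet_def F1_def F2_def g1_def g2_def f1_def f2_def Let_def)
  show "N 1 + d_dep 1 (\<eta> 1) z * F1 + d_dep 2 (\<eta> 1) z * F2 - 2 * \<sigma> z * F1 =
      a1 * (total_D0 3 (\<eta> 2) (z, p) - \<sigma> z * p $ 2 $ 3) + a5 * (total_D0 2 (\<eta> 2) (z, p) - \<sigma> z * p $ 2 $ 2) + Xf1 z"
    "N 2 + d_dep 1 (\<eta> 2) z * F1 + d_dep 2 (\<eta> 2) z * F2 - 2 * \<sigma> z * F2 =
      - a1 * (total_D0 3 (\<eta> 1) (z, p) - \<sigma> z * p $ 1 $ 3) - a5 * (total_D0 2 (\<eta> 1) (z, p) - \<sigma> z * p $ 1 $ 2) + Xf2 z"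
    using base_condition(1,2)[of z p]
    unfolding coeff2' coeff1' Xf1_def[symmetric] Xf2_def[symmetric]
    unfolding F N_def by (simp_all add: b sum_3 d_dep_3_zero algebra_simps)
qed

text \<open>Only the x-slope varies. The first-order parts of the psi-equation involve y and t
  alone, so it enters only through \<open>second_total 1 1\<close>; the slopes 0, 1 and -1 separate
  its linear and quadratic terms.\<close>

lemma d_dep_2_same:
  assumes "J = 1 \<or> J = 2" "K = 1 \<or> K = 2"
  shows "d_dep K (d_dep K (\<eta> J)) z = 0" "d_indep 1 (d_dep K (\<eta> J)) z = 0"
proof -
  note s = total_D0_slope second_total_slope smooth_\<eta> slope_nth
  define q1 q2 where q: "q1 = a * d_dep K (d_dep K (\<eta> J)) z" "q2 = a * d_indep 1 (d_dep K (\<eta> J)) z"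
  have "q1 = 0 \<and> q2 = 0"
    using assms(1)
  proof
    assume J: "J = 1"
    show ?thesis
      using first_order_conditions(1)[of z "slope K 1 0"] first_order_conditions(1)[of z "slope K 1 1"]
        first_order_conditions(1)[of z "slope K 1 (- 1)"]
      by (simp add: s) (use q in \<open>unfold J, algebra\<close>)
  next
    assume J: "J = 2"
    show ?thesis
      using first_order_conditions(2)[of z "slope K 1 0"] first_order_conditions(2)[of z "slope K 1 1"]
        first_order_conditions(2)[of z "slope K 1 (- 1)"]
      by (simp add: s) (use q in \<open>unfold J, algebra\<close>)
  qed
  then show "d_dep K (d_dep K (\<eta> J)) z = 0" "d_indep 1 (d_dep K (\<eta> J)) z = 0"
    using a by (simp_all add: q)
qed

text \<open>With u_x = v_x = 1 the pure terms are already known to vanish, so comparison with the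
  zero 1-jet leaves the mixed one.\<close>

lemma d_dep_1_2:
  assumes "J = 1 \<or> J = 2"
  shows "d_dep 1 (d_dep 2 (\<eta> J)) z = 0"
proof -
  define p :: "real^3^3" where "p = (\<chi> J i. if (J = 1 \<or> J = 2) \<and> i = 1 then 1 else 0)"
  have p: "p $ J $ i = (if (J = 1 \<or> J = 2) \<and> i = 1 then 1 else 0)" for J i
    by (simp add: p_def)
  note s = total_D0_expand second_total_expand smooth_\<eta> p sum_3 d_dep_2_same
    dir_deriv_commute[OF smooth_\<eta>, of "(0, axis 2 1)" "(0, axis 1 1)"]
  define q where q: "q = a * d_dep 1 (d_dep 2 (\<eta> J)) z"
  have "q = 0"
    using assms
  proof
    assume J: "J = 1"
    show ?thesis
      using first_order_conditions(1)[of z 0] first_order_conditions(1)[of z p]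
      by (simp add: s) (use q in \<open>unfold J, algebra\<close>)
  next
    assume J: "J = 2"
    show ?thesis
      using first_order_conditions(2)[of z 0] first_order_conditions(2)[of z p]
      by (simp add: s) (use q in \<open>unfold J, algebra\<close>)
  qed
  then show ?thesis using a by (simp add: q)
qed

text \<open>The scaling weight of phi; together with the angle \<theta> it will determine the (u,
  v)-component, see \<open>\<eta>_rotation\<close>.\<close>

definition \<tau> :: "point \<Rightarrow> real" where "\<tau> = d_dep 3 (\<eta> 3)"
definition \<theta> :: "point \<Rightarrow> real" where "\<theta> = d_dep 1 (\<eta> 2)"

lemma smooth_\<tau>: "smooth \<tau>" and smooth_\<theta>: "smooth \<theta>"
  unfolding \<tau>_def \<theta>_def by (intro smooth_dir_deriv smooth_\<eta>)+

lemma d_dep_d_dep: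
  assumes "J = 1 \<or> J = 2"
  shows "d_dep K (d_dep L (\<eta> J)) = (\<lambda>z. 0)"
proof -
  have 3: "d_dep 3 (\<eta> J) = (\<lambda>z. 0)"
    using assms d_dep_3_zero by (auto simp: fun_eq_iff)
  have *: "d_dep K (d_dep L (\<eta> J)) = (\<lambda>z. 0)" if "K = 3 \<or> L = 3" for K L
    using that 3 dir_deriv_commute[OF smooth_\<eta>, of "(0, axis K 1)" "(0, axis L 1)" J] by auto
  have "d_dep 1 (d_dep 2 (\<eta> J)) = (\<lambda>z. 0)" "d_dep 2 (d_dep 1 (\<eta> J)) = (\<lambda>z. 0)"
    using d_dep_1_2[OF assms] dir_deriv_commute[OF smooth_\<eta>, of "(0, axis 2 1)" "(0, axis 1 1)" J]
    by (simp_all add: fun_eq_iff)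
  moreover have "d_dep K (d_dep K (\<eta> J)) = (\<lambda>z. 0)" if "K = 1 \<or> K = 2" for K
    using d_dep_2_same(1)[OF assms that] by blast
  ultimately show ?thesis
    using exhaust_3[of K] exhaust_3[of L] * by metis
qed

lemma d_dep_\<tau>_12:
  assumes "K = 1 \<or> K = 2"
  shows "d_dep K \<tau> z = 0"
proof -
  have "d_dep K (\<eta> 3) = (\<lambda>z. 0)"
    using assms d_dep_\<eta>3 by (auto simp: fun_eq_iff)
  then show ?thesis
    using dir_deriv_commute[OF smooth_\<eta>, of "(0, axis K 1)" "(0, axis 3 1)" 3] by (simp add: \<tau>_def)
qed

text \<open>Differentiating \<open>\<eta>_identities\<close> once more in u and v: all second
  derivatives drop out, and each diagonal derivative equals \<tau> minus itself.\<close>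

lemma \<eta>_affine:
  shows "d_dep 1 (\<eta> 1) = (\<lambda>z. \<tau> z / 2)" "d_dep 2 (\<eta> 2) = (\<lambda>z. \<tau> z / 2)" "d_dep 2 (\<eta> 1) = (\<lambda>z. - \<theta> z)"
proof -
  have sm: "smooth (d_dep K (\<eta> J))" for J K
    by (intro smooth_dir_deriv smooth_\<eta>)
  note smooths = smooth_add smooth_diff smooth_mult smooth_coord sm smooth_\<tau>
  note rules = dir_deriv_add dir_deriv_diff dir_deriv_mult smooths d_dep_coord d_dep_d_dep d_dep_\<tau>_12
  have 1: "\<eta> 1 = (\<lambda>z. snd z $ 1 * \<tau> z - snd z $ 1 * d_dep 1 (\<eta> 1) z - snd z $ 2 * d_dep 1 (\<eta> 2) z)"
    and 2: "\<eta> 2 = (\<lambda>z. snd z $ 2 * \<tau> z - snd z $ 1 * d_dep 2 (\<eta> 1) z - snd z $ 2 * d_dep 2 (\<eta> 2) z)"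
    unfolding \<tau>_def using \<eta>_identities by blast+
  have "d_dep 1 (\<eta> 1) z = \<tau> z - d_dep 1 (\<eta> 1) z" for z
    by (subst 1) (simp add: rules)
  then show 3: "d_dep 1 (\<eta> 1) = (\<lambda>z. \<tau> z / 2)"
    by (auto simp: fun_eq_iff field_simps)
  have "d_dep 2 (\<eta> 2) z = \<tau> z - d_dep 2 (\<eta> 2) z" for z
    by (subst 2) (simp add: rules)
  then show 4: "d_dep 2 (\<eta> 2) = (\<lambda>z. \<tau> z / 2)"
    by (auto simp: fun_eq_iff field_simps)
  have "d_dep 2 (\<eta> 1) z = - \<theta> z" for z
    by (subst 1) (simp add: rules \<theta>_def)
  then show "d_dep 2 (\<eta> 1) = (\<lambda>z. - \<theta> z)"
    by blast
qed

lemma \<eta>_rotation: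
  shows "\<eta> 1 = (\<lambda>z. snd z $ 1 * (\<tau> z / 2) - snd z $ 2 * \<theta> z)"
    and "\<eta> 2 = (\<lambda>z. snd z $ 1 * \<theta> z + snd z $ 2 * (\<tau> z / 2))"
  using \<eta>_identities unfolding \<eta>_affine \<theta>_def[symmetric] \<tau>_def[symmetric]
  by (auto simp: fun_eq_iff algebra_simps)

lemma d_dep_\<theta>: "d_dep K \<theta> = (\<lambda>z. 0)"
  by (simp add: \<theta>_def d_dep_d_dep)

text \<open>Expresses \<tau> through \<open>\<eta> 1\<close>, which transfers to it the independence
  of phi and of x known for the derivatives of \<open>\<eta> 1\<close>.\<close>

lemma \<tau>_eq: "\<tau> = (\<lambda>z. 2 * d_dep 1 (\<eta> 1) z)"
  by (simp add: \<eta>_affine)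

lemma d_dep_\<tau>: "d_dep K \<tau> = (\<lambda>z. 0)"
  unfolding \<tau>_eq by (simp add: dir_deriv_cmult smooth_dir_deriv smooth_\<eta> d_dep_d_dep)

lemma d_indep_1: "d_indep 1 \<theta> = (\<lambda>z. 0)" "d_indep 1 \<tau> = (\<lambda>z. 0)"
  unfolding \<tau>_eq using d_dep_2_same(2)
  by (simp_all add: dir_deriv_cmult smooth_dir_deriv smooth_\<eta> fun_eq_iff \<theta>_def)

text \<open>The coefficients of v_y, v_t and u_y in the real part. The undifferentiated
  contributions of rotation and scaling agree on both sides and cancel.\<close>

lemma slope_conditions:
  "- 2 * a2 * d_indep 2 \<theta> z - a4 * d_indep 3 \<theta> z = \<sigma> z * a5"
  "- 2 * a3 * d_indep 3 \<theta> z - a4 * d_indep 2 \<theta> z = \<sigma> z * a1"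
  "2 * a2 * d_indep 2 \<tau> z + a4 * d_indep 3 \<tau> z = 0"
proof -
  note s = total_D0_slope second_total_slope smooth_\<eta> slope_nth d_dep_d_dep \<eta>_affine \<theta>_def[symmetric]
    dir_deriv_minus dir_deriv_divide smooth_\<theta> smooth_\<tau> d_dep_\<theta> d_dep_\<tau>
  note 0 = first_order_conditions(1)[of z "slope 2 2 0"]
  show "- 2 * a2 * d_indep 2 \<theta> z - a4 * d_indep 3 \<theta> z = \<sigma> z * a5"
    using 0 first_order_conditions(1)[of z "slope 2 2 1"]
    by (simp add: s algebra_simps; simp add: add_divide_distrib)
  show "- 2 * a3 * d_indep 3 \<theta> z - a4 * d_indep 2 \<theta> z = \<sigma> z * a1"
    using 0 first_order_conditions(1)[of z "slope 2 3 1"]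
    by (simp add: s algebra_simps; simp add: add_divide_distrib)
  show "2 * a2 * d_indep 2 \<tau> z + a4 * d_indep 3 \<tau> z = 0"
    using 0 first_order_conditions(1)[of z "slope 1 2 1"]
    by (simp add: s algebra_simps; simp add: add_divide_distrib)
qed

lemma \<sigma>_zero: "\<sigma> z = 0" and travelling_\<theta>: "travelling \<theta>" and travelling_\<tau>: "travelling \<tau>"
proof -
  define L where "L = (\<lambda>z. d * d_indep 2 \<theta> z - \<mu> * d_indep 3 \<theta> z)"
  have 1: "\<sigma> z * a5 = - 2 * e * d * L z" and 2: "\<sigma> z * a1 = 2 * e * \<mu> * L z" for z
    using slope_conditions(1,2)[of z] by (simp_all add: a234 L_def algebra_simps)
  \<comment> \<open>Both conditions are multiples of the transverse derivative \<open>L\<close>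
    along (d, -\<mu>); pairing with (\<mu>, d) kills it, while the first-order part pairs to
    \<open>1 / \<mu>\<close>.\<close>
  have "\<sigma> z * (a1 * d + a5 * \<mu>) = (\<sigma> z * a1) * d + (\<sigma> z * a5) * \<mu>" for z
    by (simp add: algebra_simps)
  also have "\<dots> z = 0" for z
    unfolding 1 2 by simp
  finally have \<sigma>: "\<sigma> z = 0" for z
    using mu by (simp add: transversal)
  then show "\<sigma> z = 0" .
  have "L z = 0" for z
    using 1[of z] e_pos d by (simp add: \<sigma>)
  then show "travelling \<theta>"
    by (simp add: travelling_def smooth_\<theta> d_dep_\<theta> d_indep_1 L_def)
  have "2 * e * d * (d * d_indep 2 \<tau> z - \<mu> * d_indep 3 \<tau> z) = 0" for z
    using slope_conditions(3)[of z] by (simp add: a234 algebra_simps)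
  then show "travelling \<tau>"
    using e_pos d by (simp add: travelling_def smooth_\<tau> d_dep_\<tau> d_indep_1)
qed

section \<open>Terms without derivatives and the equation for phi\<close>

lemma \<tau>_zero: "\<tau> z = 0" and \<eta>3_eq: "w * \<eta> 3 z = D \<theta> z / \<mu>"
proof -
  note \<theta> = travelling_partials[OF travelling_\<theta>] and \<tau> = travelling_partials[OF travelling_\<tau>]
    and D\<theta> = travelling_partials[OF travelling_D[OF travelling_\<theta>]]
    and D\<tau> = travelling_partials[OF travelling_D[OF travelling_\<tau>]]
  \<comment> \<open>At the zero 1-jet the second-order terms of \<theta> and \<tau> vanish. What is
    left is a cubic in (u, v): \<open>A\<close> multiplies u, \<open>B\<close> multiplies -u (u^2 +
    v^2), and \<open>C\<close> multiplies -v.\<close>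
  define A where "A = (\<lambda>z. w * \<eta> 3 z - D \<theta> z / \<mu>)"
  define B where "B = (\<lambda>z. (b - w * m) * \<tau> z)"
  define C where "C = (\<lambda>z. D \<tau> z / (2 * \<mu>))"
  have "d_dep 1 (\<eta> 3) = (\<lambda>z. 0)"
    using d_dep_\<eta>3 by blast
  then have A: "smooth A" "d_dep 1 A = (\<lambda>z. 0)" and B: "smooth B" "d_dep 1 B = (\<lambda>z. 0)"
    and C: "smooth C" "d_dep 1 C = (\<lambda>z. 0)"
    unfolding A_def B_def C_def
    by (simp_all add: smooth_diff smooth_cmult smooth_divide smooth_\<eta> \<theta> \<tau> D\<theta> D\<tau>
        dir_deriv_diff dir_deriv_cmult dir_deriv_divide)
  have "snd z $ 1 * A z - B z * (snd z $ 1 * (snd z $ 1 * snd z $ 1))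
      - snd z $ 1 * (B z * (snd z $ 2 * snd z $ 2)) - snd z $ 2 * C z = 0" for z
  proof -
    have k: "d_indep k (d_indep i (\<eta> 1)) z = snd z $ 1 * (d_indep k (d_indep i \<tau>) z / 2)
        - snd z $ 2 * d_indep k (d_indep i \<theta>) z"
      and i2: "d_indep i (\<eta> 2) z = snd z $ 1 * d_indep i \<theta> z + snd z $ 2 * (d_indep i \<tau> z / 2)" for i k
      unfolding \<eta>_rotation
      by (simp_all add: dir_deriv_diff dir_deriv_add dir_deriv_mult dir_deriv_divide smooth_diff smooth_add smooth_mult
          smooth_divide smooth_coord smooth_dir_deriv smooth_\<theta> smooth_\<tau> d_indep_coord)
    have N: "a * d_indep 1 (d_indep 1 (\<eta> 1)) z + a2 * d_indep 2 (d_indep 2 (\<eta> 1)) z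
       + a3 * d_indep 3 (d_indep 3 (\<eta> 1)) z + a4 * d_indep 2 (d_indep 3 (\<eta> 1)) z
      = snd z $ 1 / 2 * (a * d_indep 1 (d_indep 1 \<tau>) z + (a2 * d_indep 2 (d_indep 2 \<tau>) z
         + a3 * d_indep 3 (d_indep 3 \<tau>) z + a4 * d_indep 2 (d_indep 3 \<tau>) z))
      - snd z $ 2 * (a * d_indep 1 (d_indep 1 \<theta>) z + (a2 * d_indep 2 (d_indep 2 \<theta>) z
         + a3 * d_indep 3 (d_indep 3 \<theta>) z + a4 * d_indep 2 (d_indep 3 \<theta>) z))"
      unfolding k by (simp add: algebra_simps)
    have M: "a1 * d_indep 3 (\<eta> 2) z + a5 * d_indep 2 (\<eta> 2) z
       = snd z $ 1 * (a1 * d_indep 3 \<theta> z + a5 * d_indep 2 \<theta> z)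
         + snd z $ 2 / 2 * (a1 * d_indep 3 \<tau> z + a5 * d_indep 2 \<tau> z)"
      unfolding i2 by (simp add: algebra_simps)
    have "\<tau> z / 2 * f1 z - \<theta> z * f2 z
        = snd z $ 1 * (D \<theta> z / \<mu>) + snd z $ 2 / 2 * (D \<tau> z / \<mu>) + Xf1 z"
      using first_order_conditions(1)[of z 0] N M
      unfolding travelling_second_order[OF travelling_\<theta>] travelling_second_order[OF travelling_\<tau>]
        travelling_first_order[OF travelling_\<theta>] travelling_first_order[OF travelling_\<tau>]
      by (simp add: second_total_0 total_D0_0 smooth_\<eta> \<sigma>_zero \<eta>_affine)
    then show ?thesis
      unfolding f1_def f2_def Xf1_def A_def B_def C_def \<eta>_rotation
      by (simp add: algebra_simps add_divide_distrib diff_divide_distrib)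
  qed
  then have 0: "(\<lambda>z. snd z $ 1 * A z - B z * (snd z $ 1 * (snd z $ 1 * snd z $ 1))
      - snd z $ 1 * (B z * (snd z $ 2 * snd z $ 2)) - snd z $ 2 * C z) = (\<lambda>z. 0)"
    by blast
  note rules = dir_deriv_diff dir_deriv_add dir_deriv_mult smooth_diff smooth_add smooth_mult smooth_coord d_dep_coord A B C smooth_const
  \<comment> \<open>Three differentiations in \<open>u\<close> separate the coefficients \<open>A\<close>, \<open>B\<close>, \<open>C\<close>, which do not involve \<open>u\<close>.\<close>
  have 1: "(\<lambda>z. A z - 3 * (B z * (snd z $ 1 * snd z $ 1)) - B z * (snd z $ 2 * snd z $ 2)) = (\<lambda>z. 0)"
    using arg_cong[OF 0, of "d_dep 1"] by (simp add: rules fun_eq_iff algebra_simps)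
  have 2: "(\<lambda>z. 6 * (B z * snd z $ 1)) = (\<lambda>z. 0)"
    using arg_cong[OF 1, of "d_dep 1"] by (simp add: rules fun_eq_iff algebra_simps)
  have B0: "B z = 0" for z
    using arg_cong[OF 2, of "d_dep 1"] by (simp add: rules fun_eq_iff del: split_paired_All)
  then have A0: "A z = 0" for z
    using fun_cong[OF 1, of z] by simp
  then show "w * \<eta> 3 z = D \<theta> z / \<mu>"
    by (simp add: A_def)
  \<comment> \<open>\<open>B = 0\<close> yields \<tau> = 0 only if b differs from w m. The
    phi-derivative of \<open>A\<close> works in every case, because \<open>D \<theta>\<close> does
    not involve phi.\<close>
  have "d_dep 3 A = (\<lambda>z. w * \<tau> z)"
    unfolding A_def
    by (simp add: dir_deriv_diff dir_deriv_cmult dir_deriv_divide smooth_cmult smooth_divide smooth_\<eta> D\<theta> \<tau>_def)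
  moreover have "d_dep 3 A = (\<lambda>z. 0)"
  proof -
    have "A = (\<lambda>z. 0)" using A0 by blast
    then show ?thesis by simp
  qed
  ultimately have "w * \<tau> z = 0"
    by (metis (no_types))
  then show "\<tau> z = 0"
    using w by simp
qed

text \<open>At the zero 1-jet the second derivatives of \<theta> cancel in the source, because a
  rotation preserves the squared modulus. The phi-component must then solve the wave
  equation.\<close>

lemma D3_\<theta>: "D (D (D \<theta>)) z = 0"
proof -
  define G where "G = D \<theta>"
  have \<theta>: "travelling \<theta>" and G: "travelling G" and DG: "travelling (D G)"
    unfolding G_def by (intro travelling_D travelling_\<theta>)+
  have \<tau>: "\<tau> = (\<lambda>z. 0)" using \<tau>_zero by blast
  have e3: "\<eta> 3 = (\<lambda>z. G z / (\<mu> * w))"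
  proof
    show "\<eta> 3 z = G z / (\<mu> * w)" for z
      using \<eta>3_eq[of z] w mu(1) by (simp add: field_simps G_def)
  qed
  have e1: "d_indep k (d_indep i (\<eta> 1)) z = - snd z $ 2 * d_indep k (d_indep i \<theta>) z"
    and e2: "d_indep k (d_indep i (\<eta> 2)) z = snd z $ 1 * d_indep k (d_indep i \<theta>) z" for i k
    unfolding \<eta>_rotation \<tau>
    by (simp_all add: dir_deriv_minus dir_deriv_mult smooth_mult
          smooth_coord smooth_dir_deriv smooth_\<theta> d_indep_coord)
  have d3: "d_dep K (\<eta> 3) z = 0" for K
    using exhaust_3[of K] d_dep_\<eta>3[of z] \<tau> by (auto simp: \<tau>_def)
  have b: "base_jet z 0 $ J $ i $ k = 0" if "i \<noteq> 1" for J i k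
    using that by (simp add: base_jet_def Let_def)
  have "d_indep 1 (d_indep 1 (\<eta> 3)) z + \<kappa> * (d_indep 2 (d_indep 2 (\<eta> 3)) z - d_indep 3 (d_indep 3 (\<eta> 3)) z) = 0"
    using base_condition(3)[of z 0] unfolding coeff2'
    by (simp add: second_total_0 smooth_\<eta> d3 \<sigma>_zero b e1 e2)
  moreover have "d_indep k (d_indep i (\<eta> 3)) z = d_indep k (d_indep i G) z / (\<mu> * w)" for k i
    unfolding e3 using travelling_partials(1)[OF G]
    by (simp add: dir_deriv_divide smooth_dir_deriv)
  ultimately have "\<kappa> * (d_indep 2 (d_indep 2 G) z - d_indep 3 (d_indep 3 G) z) / (\<mu> * w) = 0"
    using travelling_second_order(1)[OF G, of 1 z] by (simp add: diff_divide_distrib) blast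
  \<comment> \<open>On functions of \<open>s\<close> the operator is a multiple of the second
    derivative, and the factor is nonzero because m and d^2 differ.\<close>
  moreover have "d_indep 2 (d_indep 2 G) z - d_indep 3 (d_indep 3 G) z = (\<mu> * \<mu> - d * d) * D (D G) z"
    using travelling_partials[OF G] travelling_partials[OF DG]
    by (simp add: dir_deriv_cmult algebra_simps)
  ultimately show ?thesis
    using kappa mu(1) w by (auto simp: G_def)
qed

lemma X_form:
  obtains k1 k2 k3 k4 k5 k6 where
    "X = (\<lambda>z. (vector [k1, k2, k3], vector [- snd z $ 2 * (k6 * (s z)\<^sup>2 + k5 * s z + k4),
        snd z $ 1 * (k6 * (s z)\<^sup>2 + k5 * s z + k4), (2 * k6 * s z + k5) / (w * \<mu>)]))"
proof -
  obtain k6 k5 k4 where \<theta>: "\<theta> = (\<lambda>z. k6 * (s z)\<^sup>2 + k5 * s z + k4)" "D \<theta> = (\<lambda>z. 2 * k6 * s z + k5)"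
    using travelling_polynomial[OF travelling_\<theta> D3_\<theta>] .
  have \<xi>: "\<xi> l z = \<xi> l 0" for l z
    by (rule constant_if_partials_zero[OF smooth_\<xi>]) (simp_all add: d_indep_\<xi> \<sigma>_zero d_dep_\<xi>)
  have "\<eta> 3 z = D \<theta> z / (w * \<mu>)" for z
    using \<eta>3_eq[of z] w mu(1) by (simp add: field_simps)
  then have 3: "\<eta> 3 z = (2 * k6 * s z + k5) / (w * \<mu>)" for z
    unfolding \<theta>(2) .
  have "X z = (vector [\<xi> 1 0, \<xi> 2 0, \<xi> 3 0], vector [\<eta> 1 z, \<eta> 2 z, \<eta> 3 z])" for z
    using \<xi>[of _ z] unfolding \<xi>_def \<eta>_def by (simp add: prod_eq_iff vec_eq_iff forall_3)
  then show thesis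
    by (intro that[of "\<xi> 1 0" "\<xi> 2 0" "\<xi> 3 0" k6 k5 k4] ext)
       (simp add: 3 \<eta>_rotation \<tau>_zero \<theta>(1))
qed

end

section \<open>The symmetry algebra\<close>

context dispersive_system
begin

lemma symmetry_algebra_eq:
  "lie_symmetry_algebra pde = {Phi k1 k2 k3 k4 k5 k6 | k1 k2 k3 k4 k5 k6. True}"
proof (intro equalityI subsetI)
  fix X assume "X \<in> lie_symmetry_algebra pde"
  then interpret symmetry_field a b c e0 d m w a1 a2 a3 a4 a5 X
    by unfold_locales
  obtain k1 k2 k3 k4 k5 k6 where
    "X = (\<lambda>z. (vector [k1, k2, k3], vector [- snd z $ 2 * (k6 * (s z)\<^sup>2 + k5 * s z + k4),
        snd z $ 1 * (k6 * (s z)\<^sup>2 + k5 * s z + k4), (2 * k6 * s z + k5) / (w * \<mu>)]))"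
    by (rule X_form)
  then have "X = Phi k1 k2 k3 k4 k5 k6"
    by (simp add: fun_eq_iff Phi_def \<Theta>_def power2_eq_square)
  then show "X \<in> {Phi k1 k2 k3 k4 k5 k6 | k1 k2 k3 k4 k5 k6. True}" by blast
qed (use Phi_symmetry in blast)

lemma lie_algebra_symmetry_algebra: "lie_algebra_of_fields (lie_symmetry_algebra pde)"
proof -
  have "subspace {Phi k1 k2 k3 k4 k5 k6 | k1 k2 k3 k4 k5 k6. True}"
  proof (rule subspaceI)
    show "0 \<in> {Phi k1 k2 k3 k4 k5 k6 | k1 k2 k3 k4 k5 k6. True}"
      unfolding Phi_0[symmetric] by blast
  next
    fix X Y
    assume "X \<in> {Phi k1 k2 k3 k4 k5 k6 | k1 k2 k3 k4 k5 k6. True}"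
      "Y \<in> {Phi k1 k2 k3 k4 k5 k6 | k1 k2 k3 k4 k5 k6. True}"
    then obtain k1 k2 k3 k4 k5 k6 l1 l2 l3 l4 l5 l6
      where "X = Phi k1 k2 k3 k4 k5 k6" "Y = Phi l1 l2 l3 l4 l5 l6"
      by blast
    then have "X + Y = Phi (k1 + l1) (k2 + l2) (k3 + l3) (k4 + l4) (k5 + l5) (k6 + l6)"
      by (simp only: Phi_add)
    then show "X + Y \<in> {Phi k1 k2 k3 k4 k5 k6 | k1 k2 k3 k4 k5 k6. True}"
      by blast
  next
    fix r X
    assume "X \<in> {Phi k1 k2 k3 k4 k5 k6 | k1 k2 k3 k4 k5 k6. True}"
    then obtain k1 k2 k3 k4 k5 k6 where "X = Phi k1 k2 k3 k4 k5 k6"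
      by blast
    then have "r *\<^sub>R X = Phi (r * k1) (r * k2) (r * k3) (r * k4) (r * k5) (r * k6)"
      by (simp only: Phi_scaleR)
    then show "r *\<^sub>R X \<in> {Phi k1 k2 k3 k4 k5 k6 | k1 k2 k3 k4 k5 k6. True}"
      by blast
  qed
  then show ?thesis
    unfolding lie_algebra_of_fields_def symmetry_algebra_eq
    using smooth_Phi lie_bracket_Phi by fastforce
qed

lemma Phi_basis:
  fixes B
  \<comment> \<open>The order of the list is that of \<open>X1\<close> to \<open>X6\<close> in the
    theorem, with the time translation first.\<close>
  defines "B \<equiv> [Phi 0 0 1 0 0 0, Phi 1 0 0 0 0 0, Phi 0 1 0 0 0 0, Phi 0 0 0 1 0 0, Phi 0 0 0 0 1 0, Phi 0 0 0 0 0 1]"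
  shows "distinct B" "independent (set B)" "span (set B) = lie_symmetry_algebra pde"
proof -
  have ne: "Phi k1 k2 k3 k4 k5 k6 \<noteq> Phi l1 l2 l3 l4 l5 l6"
    if "(k1, k2, k3, k4, k5, k6) \<noteq> (l1, l2, l3, l4, l5, l6)" for k1 k2 k3 k4 k5 k6 l1 l2 l3 l4 l5 l6
  proof
    assume "Phi k1 k2 k3 k4 k5 k6 = Phi l1 l2 l3 l4 l5 l6"
    then have "Phi k1 k2 k3 k4 k5 k6 + (- 1) *\<^sub>R Phi l1 l2 l3 l4 l5 l6 = 0" by simp
    then show False
      unfolding Phi_add Phi_scaleR using that by (auto dest!: Phi_eq_0D)
  qed
  show dist: "distinct B"
    by (simp add: B_def ne)
  \<comment> \<open>Nested to the right in the order of \<open>B\<close>, the shape into which the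
    sum over \<open>set B\<close> unfolds.\<close>
  have combination: "c3 *\<^sub>R Phi 0 0 1 0 0 0 + (c1 *\<^sub>R Phi 1 0 0 0 0 0 + (c2 *\<^sub>R Phi 0 1 0 0 0 0
      + (c4 *\<^sub>R Phi 0 0 0 1 0 0 + (c5 *\<^sub>R Phi 0 0 0 0 1 0 + c6 *\<^sub>R Phi 0 0 0 0 0 1)))) = Phi c1 c2 c3 c4 c5 c6"
    for c1 c2 c3 c4 c5 c6
    unfolding Phi_add Phi_scaleR by simp
  have sum: "(\<Sum>X\<in>set B. f X *\<^sub>R X) = Phi (f (Phi 1 0 0 0 0 0)) (f (Phi 0 1 0 0 0 0)) (f (Phi 0 0 1 0 0 0))
     (f (Phi 0 0 0 1 0 0)) (f (Phi 0 0 0 0 1 0)) (f (Phi 0 0 0 0 0 1))" for f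
    by (subst combination[symmetric]) (use dist in \<open>simp add: B_def\<close>)
  show "independent (set B)"
  proof (rule independent_if_scalars_zero)
    fix f X
    assume 0: "(\<Sum>X\<in>set B. f X *\<^sub>R X) = 0" and "X \<in> set B"
    then show "f X = 0"
      using Phi_eq_0D[OF 0[unfolded sum]] by (auto simp: B_def)
  qed simp
  show "span (set B) = lie_symmetry_algebra pde"
  proof
    show "span (set B) \<subseteq> lie_symmetry_algebra pde"
    proof (rule span_minimal)
      show "set B \<subseteq> lie_symmetry_algebra pde"
        using Phi_symmetry by (auto simp: B_def)
      show "subspace (lie_symmetry_algebra pde)"
        using lie_algebra_symmetry_algebra by (simp add: lie_algebra_of_fields_def)
    qed
    show "lie_symmetry_algebra pde \<subseteq> span (set B)"
    proof
      fix X assume "X \<in> lie_symmetry_algebra pde"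
      then obtain k1 k2 k3 k4 k5 k6 where X: "X = Phi k1 k2 k3 k4 k5 k6"
        unfolding symmetry_algebra_eq by blast
      show "X \<in> span (set B)"
        unfolding X by (subst combination[symmetric]) (intro span_add span_scale span_base; simp add: B_def)
    qed
  qed
qed

end

theorem proposition2p3:
  fixes a b c \<epsilon>0 d m w a1 a2 a3 a4 a5 :: real
    and s :: "point \<Rightarrow> real"
    and X1 X2 X3 X4 X5 X6 :: "point \<Rightarrow> point"
    and G :: "(point \<Rightarrow> point) set"
  assumes "a \<noteq> 0" "b \<noteq> 0" "c \<noteq> 0"
    and "\<epsilon>0 > 0" "d > 0" "m > 0" "w > 0" "m \<noteq> d\<^sup>2"
    and "a1 = (d - m * c) / ((d\<^sup>2 - m) * sqrt m)"
    and "a2 = \<epsilon>0 * d\<^sup>2 / (d\<^sup>2 - m)\<^sup>2"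
    and "a3 = \<epsilon>0 * m / (d\<^sup>2 - m)\<^sup>2"
    and "a4 = - (2 * \<epsilon>0 * d * sqrt m / (d\<^sup>2 - m)\<^sup>2)"
    and "a5 = (d * c - 1) / (d\<^sup>2 - m)"
    and "G = lie_symmetry_algebra (pde_system a a1 a2 a3 a4 a5 b w m d)"
    and "s = (\<lambda>z. d * coord_t z + sqrt m * coord_y z)"
    and "X1 = field_t"
    and "X2 = field_x"
    and "X3 = field_y"
    and "X4 = rot_uv"
    and "X5 = (\<lambda>z. s z *\<^sub>R rot_uv z + (1 / (w * sqrt m)) *\<^sub>R field_phi z)"
    and "X6 = (\<lambda>z. (s z)\<^sup>2 *\<^sub>R rot_uv z + (2 * s z / (w * sqrt m)) *\<^sub>R field_phi z)"
  shows "lie_algebra_of_fields G \<and> dim G = 6 \<and>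
         distinct [X1, X2, X3, X4, X5, X6] \<and>
         independent {X1, X2, X3, X4, X5, X6} \<and>
         span {X1, X2, X3, X4, X5, X6} = G"
proof -
  interpret S: dispersive_system a b c \<epsilon>0 d m w a1 a2 a3 a4 a5
    using assms(1-13) by unfold_locales
  have s: "S.s = s"
    by (simp add: assms(15) S.s_def fun_eq_iff coord_t_def coord_y_def S.\<mu>_def)
  let ?B = "[X1, X2, X3, X4, X5, X6]"
  have B: "?B = [S.Phi 0 0 1 0 0 0, S.Phi 1 0 0 0 0 0, S.Phi 0 1 0 0 0 0,
      S.Phi 0 0 0 1 0 0, S.Phi 0 0 0 0 1 0, S.Phi 0 0 0 0 0 1]"
    unfolding assms(16-21) list.inject
    by (simp add: fun_eq_iff prod_eq_iff vec_eq_iff forall_3 S.Phi_nth S.\<Theta>_def s S.\<mu>_def[symmetric] field_t_def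
        field_x_def field_y_def field_u_def field_v_def field_phi_def rot_uv_def coord_u_def coord_v_def axis_def
        power2_eq_square)
  note basis = S.Phi_basis[folded B]
  have G: "lie_algebra_of_fields G"
    unfolding assms(14) by (rule S.lie_algebra_symmetry_algebra)
  \<comment> \<open>Identifies the span of the six fields with \<open>span G\<close>, the form in
    which \<open>dim_eq_card\<close> compares a basis with a set.\<close>
  then have "span G = G"
    by (simp add: lie_algebra_of_fields_def)
  then have "span (set ?B) = span G"
    using basis(3) assms(14) by metis
  then have "dim G = card (set ?B)"
    using basis(2) by (rule dim_eq_card)
  also have "\<dots> = 6"
    using distinct_card[OF basis(1)] by simp
  finally show ?thesis
    using G basis by (simp add: assms(14))
qed

end
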